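(* Let $m\in\mathbb N$ and $Y>0$ with $m^2Y>1$. For any sequence of positive numbers $\{c_n\}_{n\in\mathbb P_m}$ there exists a sequence $\{y_n\}_{n\in\mathbb P_m}$ with $0<y_n<c_n$ for all $n\in\mathbb P_m$ such that for Lebesgue-almost every $x\in\mathbb R/\mathbb Z$, the measure $\nu_{m,Y}$ is a weak limit of some subsequence of $\{\delta_{n,x,y_n}\}_{n\in\mathbb P_m}$ (i.e. $\nu_{m,Y}$ belongs to the set of limiting measures of this sequence).
   Context: $\mathcal M=\Gamma\backslash\mathbb H$ with $\Gamma=\mathrm{SL}_2(\mathbb Z)$. $\delta_{n,x,y}=\frac1n\sum_{j=0}^{n-1}\delta_{\Gamma(x+j/n+iy)}$. $\mathbb P_m=\{n=m\ell:\ \ell\text{ prime},\ \ell\nmid m\}$. For $Y>0$, $\mu_Y$ is the uniform probability measure on the closed horocycle $\{\Gamma(t+iY):t\in\mathbb R/\mathbb Z\}$, and $\nu_{m,Y}=\frac1m\sum_{d\mid m}\varphi(\tfrac md)\mu_{d^2Y}$, with $\varphi$ Euler's totient. *)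

theory Defs
  imports "HOL-Analysis.Analysis" "HOL-Number_Theory.Totient"
begin

definition upper_half :: "complex set" where
  "upper_half = {z. Im z > 0}"

definition moebius_int :: "int \<Rightarrow> int \<Rightarrow> int \<Rightarrow> int \<Rightarrow> complex \<Rightarrow> complex" where
  "moebius_int a b c d z = (of_int a * z + of_int b) / (of_int c * z + of_int d)"

text \<open>Test functions for weak convergence of measures on the modular surface
  Gamma\H: bounded continuous functions on M, i.e. bounded continuous
  Gamma-invariant functions on H.\<close>
definition test_fun :: "(complex \<Rightarrow> real) \<Rightarrow> bool" where
  "test_fun f \<longleftrightarrow> continuous_on upper_half f \<and> bounded (f ` upper_half) \<and>
     (\<forall>a b c d. a * d - b * c = 1 \<longrightarrow>
        (\<forall>z\<in>upper_half. f (moebius_int a b c d z) = f z))"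

definition delta_int :: "nat \<Rightarrow> real \<Rightarrow> real \<Rightarrow> (complex \<Rightarrow> real) \<Rightarrow> real" where
  "delta_int n x y f = (1 / real n) * (\<Sum>j<n. f (Complex (x + real j / real n) y))"

text \<open>Integral of f against mu_Y (uniform measure on the closed horocycle at height Y).\<close>
definition mu_int :: "real \<Rightarrow> (complex \<Rightarrow> real) \<Rightarrow> real" where
  "mu_int Y f = (LINT t:{0..1}|lborel. f (Complex t Y))"

definition nu_int :: "nat \<Rightarrow> real \<Rightarrow> (complex \<Rightarrow> real) \<Rightarrow> real" where
  "nu_int m Y f = (1 / real m) *
     (\<Sum>d | d dvd m. real (totient (m div d)) * mu_int (real d ^ 2 * Y) f)"

definition P_set :: "nat \<Rightarrow> nat set" where
  "P_set m = {n. \<exists>l. prime l \<and> \<not> l dvd m \<and> n = m * l}"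

end

theory Submission
  imports Defs "HOL-Computational_Algebra.Squarefree" "HOL-Real_Asymp.Real_Asymp"
begin

text \<open>
  Suppose that \<open>x\<close> lies at distance about \<open>sqrt (y / Y) / (R n)\<close> from \<open>P / (R n)\<close>, where \<open>R\<close> is coprime
  to \<open>P\<close> and to \<open>n = m l\<close>, and \<open>R n sqrt (y Y)\<close> is small. Writing \<open>j = r + m i\<close> with \<open>r < m\<close> and
  \<open>i < l\<close>, the point \<open>x + j/n + iy\<close> is close to the rational \<open>(P + j R) / (R n)\<close>, whose denominator is
  \<open>R n / d\<close> with \<open>d = gcd (P + r R) m\<close> for all but one \<open>i\<close>. Moving this rational to infinity puts the point at
  height about \<open>d\<^sup>2 Y\<close>, and as \<open>i\<close> varies the images are equally spaced with gap \<open>1 / l\<close>. Since each \<open>d\<close>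
  arises for \<open>totient (m / d)\<close> residues \<open>r\<close>, the empirical measure is close to \<open>\<nu>\<close>.

  By Dirichlet's approximation theorem such \<open>x\<close> fill, as \<open>y\<close> tends to 0, a proportion of every interval
  which is at least a constant (depending on the precision) times \<open>1 / n\<close>. Hence \<open>y n\<close> can be chosen
  recursively so small that the set for \<open>n\<close> takes this proportion of everything left over by the
  previous sets, and since the sum of the reciprocals of the primes diverges, almost every \<open>x\<close> lies in
  infinitely many of the sets.
\<close>

section \<open>Arithmetic preliminaries\<close>

lemma prod_prime_factors_squarefree:
  fixes n :: nat
  assumes "squarefree n"
  shows "\<Prod>(prime_factors n) = n"
proof -
  have n0: "n \<noteq> 0" using assms by (metis not_squarefree_0)
  have "n = (\<Prod>p\<in>prime_factors n. p ^ multiplicity p n)"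
    using n0 by (simp add: prime_factorization_nat)
  also have "\<dots> = \<Prod>(prime_factors n)"
  proof (rule prod.cong)
    fix p assume p: "p \<in> prime_factors n"
    have "multiplicity p n \<le> 1"
      using assms n0 p by (auto simp: squarefree_factorial_semiring'')
    moreover have "multiplicity p n > 0"
      using p by (auto simp: prime_factors_multiplicity)
    ultimately have "multiplicity p n = 1" by simp
    thus "p ^ multiplicity p n = p" by simp
  qed simp
  finally show ?thesis by simp
qed

text \<open>Every positive \<open>n \<le> N\<close> is squarefree times a square, so
  \<open>harm N\<close> is at most the product of \<open>1 + 1 / p\<close> over the primes
  \<open>p \<le> N\<close>, times the sum of the inverse squares. Summability over the primes would
  bound that product by \<open>exp S\<close>, but \<open>harm\<close> is unbounded.\<close>

lemma not_summable_inverse_primes: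
  "\<not> summable (\<lambda>n::nat. if prime n then 1 / real n else 0)" (is "\<not> summable ?a")
proof
  assume sm: "summable ?a"
  define S where "S = suminf ?a"
  define D where "D = suminf (\<lambda>n. 1 / real (Suc n) ^ 2)"
  have smD: "summable (\<lambda>n. 1 / real (Suc n) ^ 2)"
    using inverse_squares_sums by (auto simp: sums_iff add.commute)
  have bound: "harm N \<le> exp S * D" for N
  proof -
    let ?A = "{p. prime p \<and> p \<le> N}"
    have finA: "finite ?A" by (rule finite_subset[of _ "{..N}"]) auto
    let ?I = "Pow ?A \<times> {1..N}"
    let ?f = "\<lambda>(T::nat set, q::nat). \<Prod>T * q ^ 2"
    \<comment> \<open>\<open>T\<close> will be the set of primes of the squarefree part of
      \<open>n\<close>. Covering is enough: a value hit twice only enlarges a sum of nonnegative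
      terms.\<close>
    have sub: "{1..N} \<subseteq> ?f ` ?I"
    proof
      fix n assume n: "n \<in> {1..N}"
      let ?s = "squarefree_part n" and ?q = "square_part n"
      have eq: "n = ?s * ?q ^ 2" by (rule squarefree_decompose)
      have q: "?q \<noteq> 0" using n eq by (metis atLeastAtMost_iff mult_0_right not_one_le_zero zero_power2)
      have sn: "?s dvd n" using eq by (metis dvd_triv_left)
      have "?q dvd n" using eq by (metis dvd_triv_right dvd_mult dvd_power_same power2_eq_square dvd_mult_left dvd_refl)
      have q1: "1 \<le> ?q" using q by linarith
      have "?q \<le> N" using \<open>?q dvd n\<close> n by (auto dest: dvd_imp_le)
      moreover have "prime_factors ?s \<subseteq> ?A"
      proof
        fix p assume "p \<in> prime_factors ?s"
        hence "prime p" "p dvd n" using sn by (auto intro: dvd_trans)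
        thus "p \<in> ?A" using n by (auto dest!: dvd_imp_le)
      qed
      moreover have "\<Prod>(prime_factors ?s) = ?s"
        by (rule prod_prime_factors_squarefree) simp
      ultimately show "n \<in> ?f ` ?I"
        using eq q1 by (intro image_eqI[of _ _ "(prime_factors ?s, ?q)"]) auto
    qed
    have "harm N = (\<Sum>n\<in>{1..N}. 1 / real n)" by (simp add: harm_def field_simps)
    also have "\<dots> \<le> (\<Sum>n\<in>?f ` ?I. 1 / real n)"
      using finA by (intro sum_mono2 sub) auto
    also have "\<dots> \<le> sum ((\<lambda>n. 1 / real n) \<circ> ?f) ?I"
      using finA by (intro sum_image_le) auto
    also have "\<dots> = (\<Sum>T\<in>Pow ?A. \<Sum>q=1..N. (\<Prod>p\<in>T. 1 / real p) * (1 / real q ^ 2))"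
      by (simp add: sum.cartesian_product o_def case_prod_unfold prod_dividef of_nat_prod)
    also have "\<dots> = (\<Sum>T\<in>Pow ?A. \<Prod>p\<in>T. 1 / real p) * (\<Sum>q=1..N. 1 / real q ^ 2)"
      by (simp add: sum_product)
    also have "(\<Sum>T\<in>Pow ?A. \<Prod>p\<in>T. 1 / real p) = (\<Prod>p\<in>?A. 1 / real p + 1)"
      by (subst prod_add[OF finA]) simp
    also have "\<dots> \<le> (\<Prod>p\<in>?A. exp (1 / real p))"
      by (intro prod_mono conjI) (auto simp: add.commute)
    also have "\<dots> = exp (\<Sum>p\<in>?A. 1 / real p)"
      using finA by (simp add: exp_sum)
    also have "(\<Sum>p\<in>?A. 1 / real p) = (\<Sum>p\<in>?A. ?a p)"
      by (intro sum.cong) auto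
    also have "\<dots> \<le> S"
      unfolding S_def using finA by (intro sum_le_suminf sm) auto
    also have "(\<Sum>q=1..N. 1 / real q ^ 2) = (\<Sum>q<N. 1 / real (Suc q) ^ 2)"
      by (rule sum.reindex_bij_witness[of _ Suc "\<lambda>q. q - 1"]) auto
    also have "\<dots> \<le> D"
      unfolding D_def by (intro sum_le_suminf smD) auto
    finally show ?thesis
      by (simp add: mult_mono mult_right_mono sum_nonneg)
  qed
  have "eventually (\<lambda>n. harm n \<ge> exp S * D + 1) sequentially"
    using harm_at_top unfolding filterlim_at_top by blast
  then obtain n where "harm n \<ge> exp S * D + 1"
    by (auto simp: eventually_sequentially)
  thus False using bound[of n] by linarith
qed

text \<open>Let \<open>t\<close> be the product of the primes of \<open>m\<close> that do not divide
  \<open>a\<close>. Then each prime of \<open>m\<close> divides exactly one of the summands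
  \<open>a\<close> and \<open>t b\<close>: if it divides \<open>a\<close>, it divides neither
  \<open>t\<close> nor \<open>b\<close>. As a product of distinct primes of \<open>m\<close>,
  \<open>t\<close> divides \<open>m\<close>.\<close>

lemma exists_multiple_shift_coprime:
  fixes a b :: int and m :: nat
  assumes "coprime a b" "m > 0"
  obtains t :: nat where "1 \<le> t" "t \<le> m" "coprime (a + int t * b) (int m)"
proof -
  define t where "t = \<Prod>{p \<in> prime_factors m. \<not> int p dvd a}"
  have fin: "finite {p \<in> prime_factors m. \<not> int p dvd a}" by simp
  have pr: "\<And>p. p \<in> {p \<in> prime_factors m. \<not> int p dvd a} \<Longrightarrow> prime p" by auto
  have t1: "t \<ge> 1" unfolding t_def
    by (intro prod_ge_1) (metis (no_types, lifting) pr prime_ge_1_nat)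
  have "t dvd \<Prod>(prime_factors m)" unfolding t_def
    by (rule prod_dvd_prod_subset) auto
  also have "\<dots> dvd (\<Prod>p\<in>prime_factors m. p ^ multiplicity p m)"
    by (intro prod_dvd_prod) (auto simp: prime_factors_multiplicity intro!: dvd_power)
  also have "\<dots> = m" using assms by (simp add: prime_factorization_nat[symmetric])
  finally have "t \<le> m" using assms by (auto dest: dvd_imp_le)
  moreover have "coprime (a + int t * b) (int m)"
  proof (rule ccontr)
    assume "\<not> ?thesis"
    then obtain q where q: "prime q" "q dvd a + int t * b" "q dvd int m"
      by (auto simp: coprime_iff_gcd_eq_1 intro: that elim: prime_factor_int) (metis (no_types, lifting) gcd_ge_0_int gcd_greatest_iff prime_factor_int abs_of_nonneg)
    define p where "p = nat q"
    have qp: "q = int p" using q(1) by (simp add: p_def prime_ge_0_int)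
    have p: "prime p" "p dvd m" using q unfolding qp by simp_all
    hence pf: "p \<in> prime_factors m" using assms by (simp add: in_prime_factors_iff)
    show False
    proof (cases "int p dvd a")
      case True
      hence "int p dvd int t * b" using q(2) unfolding qp by (simp add: dvd_add_right_iff)
      hence "int p dvd int t \<or> int p dvd b" using q(1) unfolding qp by (simp add: prime_dvd_mult_iff)
      moreover have "\<not> p dvd t"
      proof
        assume "p dvd t"
        then obtain r where r: "r \<in> {p \<in> prime_factors m. \<not> int p dvd a}" "p dvd r"
          unfolding t_def using p(1) fin by (auto simp: prime_dvd_prod_iff)
        hence "p = r" using p(1) pr by (simp add: primes_dvd_imp_eq)
        thus False using r True by auto
      qed
      ultimately have "int p dvd b" by simp
      with True assms(1) have "is_unit (int p)" using coprime_common_divisor by blast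
      thus False using p(1) by auto
    next
      case False
      hence "p dvd t" unfolding t_def using pf fin by (intro dvd_prodI[of _ _ "\<lambda>x. x", simplified]) auto
      hence "int p dvd int t * b" by simp
      hence "int p dvd a" using q(2) unfolding qp by (simp add: dvd_add_left_iff)
      thus False using False by simp
    qed
  qed
  ultimately show ?thesis using t1 that by blast
qed

text \<open>The denominator of the Dirichlet fraction \<open>h / k\<close> may share factors with
  \<open>m l\<close>. Adding \<open>t\<close> times \<open>(h, k)\<close> to a Farey neighbour
  \<open>(h', k')\<close> keeps the determinant 1, so the result is reduced, and \<open>t\<close>
  can be chosen to remove common factors. The lower bound on \<open>k\<close> matters because the
  neighbour brings an error of about \<open>1 / k\<close>.\<close>

lemma exists_good_approximation:
  fixes \<alpha> :: real and m l N :: nat and h k :: int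
  assumes m: "m > 0" and l: "prime l" "\<not> l dvd m" and N: "N > 0"
    and hk: "coprime h k" "0 < k" "k \<le> int N" "\<bar>of_int k * \<alpha> - of_int h\<bar> \<le> 1 / N"
    and k: "real N \<le> 16 * k"
  obtains P R :: int where "coprime P R" "coprime R (int (m * l))" "1 \<le> R" "R \<le> 3 * int m * int N"
    "\<bar>of_int R * \<alpha> - of_int P\<bar> \<le> (17 + 2 * real m) / N"
proof -
  \<comment> \<open>\<open>k'\<close> is an inverse of \<open>- h\<close> modulo \<open>k\<close>;
    the quotient \<open>h'\<close> of \<open>h k' + 1\<close> by \<open>k\<close> completes the
    Farey neighbour.\<close>
  obtain k' where k': "0 \<le> k'" "k' < k" "k dvd h * k' + 1"
  proof -
    obtain z where z: "[h * z = 1] (mod k)" using cong_solve_coprime_int[OF hk(1)] by blast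
    show ?thesis
    proof (rule that[of "(- z) mod k"])
      have "[h * ((- z) mod k) + 1 = h * (- z) + 1] (mod k)"
        by (intro cong_add cong_mult) (auto simp: cong_def)
      also have "[h * (- z) + 1 = (-1) * (h * z) + 1] (mod k)" by simp
      also have "[(-1) * (h * z) + 1 = (-1) * 1 + 1] (mod k)"
        by (intro cong_add cong_mult z) auto
      finally show "k dvd h * ((- z) mod k) + 1" by (simp add: cong_0_iff)
    qed (use hk(2) in auto)
  qed
  then obtain h' where h': "h * k' + 1 = k * h'" by (auto elim: dvdE)
  have cop: "coprime k' k"
  proof (rule coprimeI)
    fix c assume "c dvd k'" "c dvd k"
    hence "c dvd k * h' - h * k'" by simp
    also have "k * h' - h * k' = 1" using h' by simp
    finally show "is_unit c" .
  qed
  obtain t0 where t0: "1 \<le> t0" "t0 \<le> m" "coprime (k' + int t0 * k) (int m)"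
    using exists_multiple_shift_coprime[OF cop m] by blast
  have lm: "coprime (int l) (int m)" using l by (simp add: prime_imp_coprime)
  \<comment> \<open>If \<open>t0\<close> fails at \<open>l\<close>, then \<open>t0 + m\<close>
    works: the residue modulo \<open>m\<close> is unchanged, and if \<open>l\<close> divided both
    values it would divide \<open>m k\<close>, hence \<open>k\<close> and then \<open>k'\<close>,
    which are coprime.\<close>
  obtain t :: nat where t: "1 \<le> t" "t \<le> 2 * m" "coprime (k' + int t * k) (int m)"
    "coprime (k' + int t * k) (int l)"
  proof (cases "int l dvd k' + int t0 * k")
    case False
    hence "coprime (k' + int t0 * k) (int l)"
      using l(1) by (metis coprime_commute prime_imp_coprime prime_nat_int_transfer)
    thus ?thesis using t0 by (intro that[of t0]) auto
  next
    case True
    have "\<not> int l dvd k' + int (t0 + m) * k"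
    proof
      assume "int l dvd k' + int (t0 + m) * k"
      hence "int l dvd k' + int (t0 + m) * k - (k' + int t0 * k)" using True by (rule dvd_diff)
      hence "int l dvd int m * k" by (simp add: algebra_simps)
      hence lk: "int l dvd k" using lm by (simp add: coprime_dvd_mult_right_iff)
      hence "int l dvd k'" using True by (simp add: dvd_add_left_iff)
      hence "is_unit (int l)" using lk cop coprime_common_divisor by blast
      thus False using l by auto
    qed
    hence "coprime (k' + int (t0 + m) * k) (int l)"
      using l(1) by (metis coprime_commute prime_imp_coprime prime_nat_int_transfer)
    moreover have "k' + int (t0 + m) * k = (k' + int t0 * k) + k * int m" by (simp add: algebra_simps)
    hence "coprime (k' + int (t0 + m) * k) (int m)"
      using t0(3) by (metis coprime_iff_gcd_eq_1 gcd_add_mult gcd.commute add.commute)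
    ultimately show ?thesis using t0 by (intro that[of "t0 + m"]) auto
  qed
  define R where "R = k' + int t * k"
  define P where "P = h' + int t * h"
  have det: "P * k - R * h = 1" using h' by (simp add: P_def R_def algebra_simps)
  show ?thesis
  proof (rule that[of P R])
    show "coprime P R"
    proof (rule coprimeI)
      fix c assume "c dvd P" "c dvd R"
      hence "c dvd P * k - R * h" by simp
      thus "is_unit c" using det by simp
    qed
    show "coprime R (int (m * l))" using t by (simp add: R_def)
    have "1 * k \<le> int t * k" using t hk by (intro mult_right_mono) auto
    thus "1 \<le> R" using k'(1) hk(2) unfolding R_def by linarith
    have "R \<le> int N + int t * int N" unfolding R_def using k' hk
      by (intro add_mono mult_left_mono) auto
    also have "\<dots> = (1 + int t) * int N" by (simp add: algebra_simps)
    also have "\<dots> \<le> (3 * int m) * int N" using t m by (intro mult_right_mono) auto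
    finally show "R \<le> 3 * int m * int N" .
    have kpos: "real_of_int k > 0" using hk by simp
    have h'r: "of_int h * of_int k' + 1 = of_int k * (of_int h' :: real)"
      using h' by (metis of_int_1 of_int_add of_int_mult)
    \<comment> \<open>The first term is at most \<open>1 / N\<close> because \<open>k' < k\<close>,
      the second at most \<open>16 / N\<close>; this is the 17 in the bound. The \<open>t\<close>
      copies of the error of \<open>h / k\<close> add \<open>2 m / N\<close>.\<close>
    have eq: "of_int k' * \<alpha> - of_int h' = (of_int k' / of_int k) * (of_int k * \<alpha> - of_int h) - 1 / of_int k"
    proof -
      have *: "of_int h' = (of_int h * of_int k' + 1) / (of_int k :: real)"
        using kpos h'r by (simp add: field_simps)
      show ?thesis unfolding * using kpos by (simp add: field_simps)
    qed
    have b0: "\<bar>(of_int k' / of_int k) * (of_int k * \<alpha> - of_int h)\<bar> \<le> 1 * (1 / N)"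
      unfolding abs_mult using k' kpos hk by (intro mult_mono) auto
    have bk: "1 / real_of_int k \<le> 16 / N" using k kpos N by (simp add: field_simps)
    have b1: "\<bar>of_int k' * \<alpha> - of_int h'\<bar> \<le> 17 / N"
    proof -
      have "17 / real N = 1 / N + 16 / N" by (simp add: add_divide_distrib[symmetric])
      moreover have "\<bar>X - Z\<bar> \<le> A + B" if "\<bar>X\<bar> \<le> A" "Z \<le> B" "0 < Z" for X Z A B :: real
        using that by linarith
      ultimately show ?thesis unfolding eq using b0 bk kpos by (metis divide_pos_pos mult_1 zero_less_one)
    qed
    have b2: "\<bar>real t * (of_int k * \<alpha> - of_int h)\<bar> \<le> (2 * real m) * (1 / N)"
      unfolding abs_mult using t hk by (intro mult_mono) auto
    have "of_int R * \<alpha> - of_int P = (of_int k' * \<alpha> - of_int h') + real t * (of_int k * \<alpha> - of_int h)"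
      by (simp add: R_def P_def algebra_simps)
    thus "\<bar>of_int R * \<alpha> - of_int P\<bar> \<le> (17 + 2 * real m) / N"
      using b1 b2 by (simp add: add_divide_distrib)
  qed
qed

section \<open>Translates near a cusp\<close>

lemma test_fun_moebius:
  assumes "test_fun f" "a * d - b * c = 1" "Im z > 0"
  shows "f (moebius_int a b c d z) = f z"
  using assms unfolding test_fun_def upper_half_def by blast

lemma test_fun_add_int:
  assumes "test_fun f" "y > 0"
  shows "f (Complex (x + of_int k) y) = f (Complex x y)"
proof -
  have "moebius_int 1 k 0 1 (Complex x y) = Complex (x + of_int k) y"
    by (simp add: moebius_int_def complex_eq_iff)
  thus ?thesis using test_fun_moebius[OF assms(1), of 1 1 k 0 "Complex x y"] assms(2) by simp
qed

lemma Re_neg_inverse: "Re (- 1 / w) = - Re w / (cmod w)\<^sup>2"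
  and Im_neg_inverse: "Im (- 1 / w) = Im w / (cmod w)\<^sup>2"
  by (simp_all add: Re_divide Im_divide cmod_power2)

text \<open>With \<open>\<alpha> a + 1 = b \<beta>\<close>, the matrix with rows
  \<open>(\<alpha>, - \<beta>)\<close> and \<open>(b, - a)\<close> has determinant 1 and sends
  \<open>a / b\<close> to infinity. It maps \<open>a / b + w\<close> to
  \<open>\<alpha> / b - 1 / (b^2 w)\<close>.\<close>

lemma test_fun_at_cusp:
  fixes a b \<alpha> :: int
  assumes f: "test_fun f" and b: "b > 0" and dvd: "b dvd \<alpha> * a + 1" and w: "Im w > 0"
  shows "f (of_real (of_int a / of_int b) + w) =
    f (Complex (of_int \<alpha> / of_int b - Re w / ((of_int b)\<^sup>2 * (cmod w)\<^sup>2))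
       (Im w / ((of_int b)\<^sup>2 * (cmod w)\<^sup>2)))"
proof -
  obtain \<beta> where \<beta>: "\<alpha> * a + 1 = b * \<beta>" using dvd by (auto elim: dvdE)
  let ?z = "of_real (of_int a / of_int b) + w"
  have w0: "w \<noteq> 0" using w by auto
  have det: "\<alpha> * (- a) - (- \<beta>) * b = 1" using \<beta> by (simp add: algebra_simps)
  have \<beta>c: "of_int \<alpha> * of_int a + 1 = of_int b * (of_int \<beta> :: complex)"
    using \<beta> by (metis of_int_1 of_int_add of_int_mult)
  have b0: "(of_int b :: complex) \<noteq> 0" using b by simp
  have "of_int b * ?z + of_int (- a) = of_int b * w" using b0 by (simp add: field_simps)
  moreover have "of_int \<alpha> * ?z + of_int (- \<beta>) = of_int \<alpha> * w - 1 / of_int b"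
  proof -
    have "of_int \<beta> = (of_int \<alpha> * of_int a + 1) / (of_int b :: complex)"
      using \<beta>c b0 by (simp add: field_simps)
    thus ?thesis using b0 by (simp add: field_simps)
  qed
  ultimately have "moebius_int \<alpha> (- \<beta>) b (- a) ?z = (of_int \<alpha> * w - 1 / of_int b) / (of_int b * w)"
    unfolding moebius_int_def by (simp only:)
  also have "\<dots> = of_real (of_int \<alpha> / of_int b) + of_real (1 / (of_int b)\<^sup>2) * (- 1 / w)"
    using b0 w0 by (simp add: field_simps power2_eq_square)
  also have "\<dots> = Complex (of_int \<alpha> / of_int b - Re w / ((of_int b)\<^sup>2 * (cmod w)\<^sup>2))
       (Im w / ((of_int b)\<^sup>2 * (cmod w)\<^sup>2))"
    unfolding complex_eq_iff plus_complex.sel Re_complex_of_real Im_complex_of_real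
      times_complex.sel Re_neg_inverse Im_neg_inverse by simp
  finally show ?thesis
    using test_fun_moebius[OF f det, of ?z] w by simp
qed

text \<open>The fractions \<open>(a0 + i B) / (B l)\<close> that are reduced have inverses modulo \<open>B l\<close> in one
  residue class modulo \<open>B\<close>, hence moving them to infinity gives distinct points of spacing \<open>1 / l\<close>;
  exactly one \<open>i\<close> is lost.\<close>
lemma sum_test_fun_to_horocycle:
  fixes a0 B :: int and l :: nat
  assumes f: "test_fun f" and l: "prime l" and B: "B > 0" "coprime a0 B" "coprime B (int l)"
    and w: "Im w > 0" and C: "\<And>z. Im z > 0 \<Longrightarrow> \<bar>f z\<bar> \<le> C"
  obtains \<kappa> where "\<bar>(\<Sum>i<l. f (of_real (of_int a0 / (of_int B * real l) + real i / real l) + w)) -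
    (\<Sum>t<l. f (Complex (\<kappa> + real t / real l) (Im w / ((of_int B * real l)\<^sup>2 * (cmod w)\<^sup>2))))\<bar> \<le> 2 * C"
proof -
  let ?b = "B * int l"
  let ?h = "Im w / ((of_int B * real l)\<^sup>2 * (cmod w)\<^sup>2)"
  \<comment> \<open>The rational points are \<open>a i / (B l)\<close>. As \<open>a i\<close> is
    always coprime to \<open>B\<close>, they are reduced exactly for the indices in
    \<open>G\<close>.\<close>
  define a where "a i = a0 + int i * B" for i :: nat
  define G where "G = {i. i < l \<and> \<not> int l dvd a i}"
  have l0: "l > 0" using l prime_gt_0_nat by blast
  have b0: "?b > 0" using B l0 by simp
  have w0: "cmod w > 0" using w by auto
  have h0: "?h > 0" using w B l0 w0 by simp
  have copB: "coprime (a i) B" for i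
    using B(2) unfolding a_def by (metis coprime_iff_gcd_eq_1 gcd_add_mult gcd.commute add.commute)
  have inj_a: "i = j" if "i < l" "j < l" "[a i = a j] (mod int l)" for i j
  proof -
    have "int l dvd (int i - int j) * B"
      using that(3) by (simp add: a_def cong_iff_dvd_diff algebra_simps)
    hence "int l dvd int i - int j"
      using B(3) by (metis coprime_commute coprime_dvd_mult_left_iff)
    hence "[int i = int j] (mod int l)" by (simp add: cong_iff_dvd_diff)
    thus ?thesis using that by (auto simp: cong_int_iff cong_less_modulus_unique_nat)
  qed
  have "\<exists>\<alpha>. 0 \<le> \<alpha> \<and> \<alpha> < ?b \<and> ?b dvd \<alpha> * a i + 1" if "i \<in> G" for i
  proof -
    have "coprime (a i) (int l)"
      using that l unfolding G_def by (auto simp: coprime_commute prime_imp_coprime)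
    hence "coprime (a i) ?b" using copB by simp
    then obtain z where z: "[a i * z = 1] (mod ?b)" using cong_solve_coprime_int by blast
    have "[((- z) mod ?b) * a i + 1 = (- z) * a i + 1] (mod ?b)"
      by (intro cong_add cong_mult) (auto simp: cong_def)
    also have "[(- z) * a i + 1 = (-1) * (a i * z) + 1] (mod ?b)" by (simp add: mult.commute)
    also have "[(-1) * (a i * z) + 1 = (-1) * 1 + 1] (mod ?b)"
      by (intro cong_add cong_mult z) auto
    finally have "?b dvd ((- z) mod ?b) * a i + 1" by (simp add: cong_0_iff)
    thus ?thesis using b0 by (intro exI[of _ "(- z) mod ?b"]) auto
  qed
  then obtain \<alpha> where \<alpha>: "\<And>i. i \<in> G \<Longrightarrow> 0 \<le> \<alpha> i" "\<And>i. i \<in> G \<Longrightarrow> \<alpha> i < ?b"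
    "\<And>i. i \<in> G \<Longrightarrow> ?b dvd \<alpha> i * a i + 1" by metis
  \<comment> \<open>All \<open>a i\<close> agree modulo \<open>B\<close>, hence so do the inverses
    \<open>\<alpha> i\<close> of \<open>- a i\<close>. This gives
    \<open>\<alpha> i = \<alpha>0 + B t i\<close>, and dividing by \<open>B l\<close> turns
    \<open>t i\<close> into a shift by \<open>t i / l\<close>.\<close>
  have \<alpha>_mod: "\<alpha> i mod B = \<alpha> j mod B" if "i \<in> G" "j \<in> G" for i j
  proof -
    have *: "B dvd \<alpha> i * a0 + 1" if "i \<in> G" for i
    proof -
      have "B dvd \<alpha> i * a i + 1" using \<alpha>(3)[OF that] by (rule dvd_mult_left)
      hence "B dvd (\<alpha> i * a0 + 1) + B * (\<alpha> i * int i)" by (simp add: a_def algebra_simps)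
      thus ?thesis by (simp add: dvd_add_left_iff)
    qed
    have "B dvd (\<alpha> i * a0 + 1) - (\<alpha> j * a0 + 1)" using that by (intro dvd_diff *)
    hence "B dvd (\<alpha> i - \<alpha> j) * a0" by (simp add: algebra_simps)
    hence "B dvd \<alpha> i - \<alpha> j" using B(2) by (metis coprime_commute coprime_dvd_mult_left_iff)
    thus ?thesis by (simp add: mod_eq_dvd_iff)
  qed
  obtain \<alpha>0 where \<alpha>0: "\<And>i. i \<in> G \<Longrightarrow> \<alpha> i mod B = \<alpha>0" using \<alpha>_mod by metis
  define t where "t i = nat (\<alpha> i div B)" for i
  have \<alpha>t: "\<alpha> i = \<alpha>0 + B * int (t i)" if "i \<in> G" for i
  proof -
    have "\<alpha> i div B \<ge> 0" using \<alpha>(1)[OF that] B(1) by (simp add: pos_imp_zdiv_nonneg_iff)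
    thus ?thesis unfolding t_def using \<alpha>0[OF that] mod_mult_div_eq[of "\<alpha> i" B] by simp
  qed
  have t_less: "t i < l" if "i \<in> G" for i
  proof -
    have "B * (\<alpha> i div B) \<le> \<alpha> i" using B(1) by (metis minus_mod_eq_mult_div mod_pos_pos_trivial pos_mod_sign diff_ge_0_iff_ge le_add_same_cancel1 diff_add_cancel add.commute)
    hence "B * (\<alpha> i div B) < B * int l" using \<alpha>(2)[OF that] by linarith
    hence "\<alpha> i div B < int l" using B(1) by (simp only: mult_less_cancel_left_pos)
    thus ?thesis unfolding t_def using l0 by linarith
  qed
  have inj_t: "inj_on t G"
  proof (rule inj_onI)
    fix i j assume ij: "i \<in> G" "j \<in> G" "t i = t j"
    hence eq: "\<alpha> i = \<alpha> j" using \<alpha>t by simp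
    have "int l dvd (\<alpha> i * a i + 1) - (\<alpha> j * a j + 1)"
      using \<alpha>(3) ij by (intro dvd_diff; meson dvd_mult_right)
    hence "int l dvd \<alpha> i * (a i - a j)" using eq by (simp add: algebra_simps)
    moreover have "coprime (int l) (\<alpha> i)"
    proof (rule coprimeI)
      fix c assume c: "c dvd int l" "c dvd \<alpha> i"
      have "c dvd \<alpha> i * a i + 1" using c(1) \<alpha>(3)[OF ij(1)] by (meson dvd_mult_right dvd_trans)
      thus "is_unit c" using c(2) by (simp add: dvd_add_right_iff)
    qed
    ultimately have "int l dvd a i - a j" by (simp add: coprime_dvd_mult_right_iff)
    thus "i = j" using ij by (intro inj_a) (auto simp: G_def cong_iff_dvd_diff)
  qed
  have finG: "finite G" "G \<subseteq> {..<l}" by (auto simp: G_def)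
  have card_bad: "card ({..<l} - G) \<le> 1"
  proof -
    have "i = j" if "i \<in> {..<l} - G" "j \<in> {..<l} - G" for i j
      using that by (intro inj_a) (auto simp: G_def cong_iff_dvd_diff)
    thus ?thesis by (metis One_nat_def card_le_Suc0_iff_eq finite_Diff finite_lessThan)
  qed
  \<comment> \<open>The injection \<open>t\<close> misses as many values as \<open>G\<close> misses
    indices. So each of the two sums has at most one unmatched term, whence the bound
    \<open>2 * C\<close>.\<close>
  have card_bad': "card ({..<l} - t ` G) \<le> 1"
  proof -
    have "card ({..<l} - t ` G) = l - card G"
      using t_less finG inj_t by (subst card_Diff_subset) (auto simp: card_image)
    also have "\<dots> = card ({..<l} - G)" using finG by (subst card_Diff_subset) auto
    finally show ?thesis using card_bad by simp
  qed
  \<comment> \<open>The part of the new real part that does not depend on \<open>i\<close>: the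
    common residue and the contribution of \<open>Re w\<close>.\<close>
  define \<kappa> where "\<kappa> = of_int \<alpha>0 / (of_int B * real l) - Re w / ((of_int B * real l)\<^sup>2 * (cmod w)\<^sup>2)"
  let ?F = "\<lambda>i. f (of_real (of_int a0 / (of_int B * real l) + real i / real l) + w)"
  let ?H = "\<lambda>t. f (Complex (\<kappa> + real t / real l) ?h)"
  have FH: "?F i = ?H (t i)" if "i \<in> G" for i
  proof -
    have "of_int a0 / (of_int B * real l) + real i / real l = of_int (a i) / of_int ?b"
      using B l0 by (simp add: a_def field_simps)
    moreover have "f (of_real (of_int (a i) / of_int ?b) + w) =
      f (Complex (of_int (\<alpha> i) / of_int ?b - Re w / ((of_int ?b)\<^sup>2 * (cmod w)\<^sup>2))
       (Im w / ((of_int ?b)\<^sup>2 * (cmod w)\<^sup>2)))"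
      by (rule test_fun_at_cusp[OF f b0 \<alpha>(3)[OF that] w])
    moreover have "of_int (\<alpha> i) / of_int ?b - Re w / ((of_int ?b)\<^sup>2 * (cmod w)\<^sup>2) = \<kappa> + real (t i) / real l"
      using B l0 \<alpha>t[OF that] by (simp add: \<kappa>_def add_divide_distrib)
    ultimately show ?thesis by simp
  qed
  have bd: "\<bar>sum g A\<bar> \<le> C" if "card A \<le> 1" "finite A" "\<And>i. i \<in> A \<Longrightarrow> \<bar>g i\<bar> \<le> C" for A :: "nat set" and g
  proof -
    have C0: "C \<ge> 0" using C[OF w] by linarith
    have "\<bar>sum g A\<bar> \<le> (\<Sum>i\<in>A. \<bar>g i\<bar>)" by (rule sum_abs)
    also have "\<dots> \<le> real (card A) * C" using that by (intro sum_bounded_above) auto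
    also have "\<dots> \<le> 1 * C" using that C0 by (intro mult_right_mono) auto
    finally show ?thesis by simp
  qed
  have s1: "sum ?F {..<l} = sum ?F G + sum ?F ({..<l} - G)"
    using finG by (simp add: sum.subset_diff add.commute)
  have "t ` G \<subseteq> {..<l}" using t_less by auto
  hence s2: "sum ?H {..<l} = sum ?H (t ` G) + sum ?H ({..<l} - t ` G)"
    by (simp add: sum.subset_diff add.commute)
  have s3: "sum ?H (t ` G) = sum ?F G"
    using inj_t FH by (simp add: sum.reindex)
  have b1: "\<bar>sum ?F ({..<l} - G)\<bar> \<le> C" using w by (intro bd card_bad C) auto
  have b2: "\<bar>sum ?H ({..<l} - t ` G)\<bar> \<le> C" using h0 by (intro bd card_bad' C) auto
  show ?thesis
    by (rule that[of \<kappa>]) (use s1 s2 s3 b1 b2 in linarith)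
qed

text \<open>A shift by \<open>1 / l\<close> advances every sample point by one index, so the
  difference telescopes to the values at \<open>\<kappa> + 1\<close> and \<open>\<kappa>\<close>,
  which periodicity makes equal.\<close>

lemma sum_periodic_shift:
  fixes g :: "real \<Rightarrow> real" and l :: nat and k :: int
  assumes per: "\<And>x. g (x + 1) = g x" and l: "l > 0"
  shows "(\<Sum>t<l. g (\<kappa> + of_int k / l + real t / l)) = (\<Sum>t<l. g (\<kappa> + real t / l))"
proof -
  have step: "(\<Sum>t<l. g (\<kappa> + 1 / l + real t / l)) = (\<Sum>t<l. g (\<kappa> + real t / l))" for \<kappa>
  proof -
    have "(\<Sum>t<l. g (\<kappa> + 1 / l + real t / l)) - (\<Sum>t<l. g (\<kappa> + real t / l)) =
      (\<Sum>t<l. g (\<kappa> + real (Suc t) / l) - g (\<kappa> + real t / l))"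
      by (simp add: sum_subtractf add_divide_distrib add_ac)
    also have "\<dots> = g (\<kappa> + real l / l) - g (\<kappa> + real 0 / l)"
      by (rule sum_lessThan_telescope)
    also have "\<dots> = 0" using l per by simp
    finally show ?thesis by simp
  qed
  show ?thesis
  proof (induction k rule: int_induct[where k = 0])
    case (step1 i)
    have "(\<Sum>t<l. g (\<kappa> + of_int (i + 1) / l + real t / l)) = (\<Sum>t<l. g ((\<kappa> + of_int i / l) + 1 / l + real t / l))"
      by (simp add: add_divide_distrib add_ac)
    thus ?case using step1 step by simp
  next
    case (step2 i)
    have "(\<Sum>t<l. g (\<kappa> + of_int i / l + real t / l)) = (\<Sum>t<l. g ((\<kappa> + of_int (i - 1) / l) + 1 / l + real t / l))"
      by (simp add: diff_divide_distrib)
    thus ?case using step2 step by simp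
  qed simp
qed

text \<open>Uniform continuity on a compact rectangle around the horocycle makes the Riemann sum
  error uniform in \<open>\<kappa>\<close> and in \<open>h\<close> near \<open>h0\<close>.
  Uniformity in \<open>\<kappa>\<close> is essential, as nothing is known about the offset that
  arises at a cusp.\<close>

lemma horocycle_riemann_sum:
  assumes f: "test_fun f" and h0: "h0 > 0" and \<eta>: "\<eta> > 0"
  obtains \<rho> where "\<rho> > 0"
    "\<And>l \<kappa> h. \<lbrakk>l > 0; 1 / real l < \<rho>; \<bar>h - h0\<bar> < \<rho>\<rbrakk> \<Longrightarrow>
       \<bar>(1 / real l) * (\<Sum>t<l. f (Complex (\<kappa> + real t / real l) h)) - mu_int h0 f\<bar> \<le> \<eta>"
proof -
  let ?K = "cbox (Complex 0 (h0 / 2)) (Complex 2 (2 * h0))"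
  have K: "z \<in> ?K \<longleftrightarrow> 0 \<le> Re z \<and> Re z \<le> 2 \<and> h0 / 2 \<le> Im z \<and> Im z \<le> 2 * h0" for z
    by (auto simp: in_cbox_complex_iff)
  have cf: "continuous_on upper_half f" using f by (simp add: test_fun_def)
  have "uniformly_continuous_on ?K f"
    using h0 by (intro compact_uniformly_continuous continuous_on_subset[OF cf])
      (auto simp: upper_half_def in_cbox_complex_iff)
  then obtain d where d: "d > 0" "\<And>z w. z \<in> ?K \<Longrightarrow> w \<in> ?K \<Longrightarrow> dist w z < d \<Longrightarrow> dist (f w) (f z) < \<eta>"
    using \<eta> unfolding uniformly_continuous_on_def by metis
  \<comment> \<open>Horizontal and vertical displacement may each use \<open>d / 2\<close>; the
    bound \<open>h0 / 2\<close> keeps \<open>h\<close> within the heights of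
    \<open>?K\<close>.\<close>
  define \<rho> where "\<rho> = min (d / 2) (min (h0 / 2) 1)"
  have \<rho>: "\<rho> > 0" "\<rho> \<le> d / 2" "\<rho> \<le> h0 / 2" "\<rho> \<le> 1" using d h0 by (auto simp: \<rho>_def)
  show ?thesis
  proof (rule that[OF \<rho>(1)])
    fix l :: nat and \<kappa> h :: real
    assume l: "l > 0" "1 / real l < \<rho>" and h: "\<bar>h - h0\<bar> < \<rho>"
    have hpos: "h > 0" using h \<rho> h0 by linarith
    \<comment> \<open>Removing a multiple of \<open>1 / l\<close> from \<open>\<kappa>\<close> puts
      the sample of index \<open>t\<close> into the cell from \<open>t / l\<close> to
      \<open>(t + 1) / l\<close>, over which the integral is compared with it.\<close>
    define k where "k = \<lfloor>\<kappa> * l\<rfloor>"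
    define \<kappa>' where "\<kappa>' = \<kappa> - of_int k / l"
    have k': "of_int k \<le> \<kappa> * l" "\<kappa> * l < of_int k + 1" unfolding k_def by linarith+
    have "\<kappa> \<le> (of_int k + 1) / l" "of_int k / l \<le> \<kappa>" using k' l(1) by (simp_all add: field_simps)
    hence \<kappa>': "0 \<le> \<kappa>'" "\<kappa>' \<le> 1 / l" unfolding \<kappa>'_def by (simp_all add: add_divide_distrib)
    have "(\<Sum>t<l. f (Complex (\<kappa>' + of_int k / l + real t / l) h)) = (\<Sum>t<l. f (Complex (\<kappa>' + real t / l) h))"
      using test_fun_add_int[OF f hpos, of _ 1] l(1) by (intro sum_periodic_shift[where g = "\<lambda>x. f (Complex x h)"]) auto
    hence eq: "(\<Sum>t<l. f (Complex (\<kappa> + real t / l) h)) = (\<Sum>t<l. f (Complex (\<kappa>' + real t / l) h))"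
      by (simp add: \<kappa>'_def)
    let ?g = "\<lambda>x. f (Complex x h0)"
    have cg: "continuous_on S ?g" for S
      using h0 by (intro continuous_on_compose2[OF cf] continuous_intros)
        (auto simp: upper_half_def Complex_eq intro!: continuous_intros)
    have int: "?g integrable_on {a..b}" for a b by (intro integrable_continuous_real cg)
    have "set_integrable lborel {0..1} ?g"
      by (intro borel_integrable_atLeastAtMost') (rule cg)
    hence mu: "mu_int h0 f = integral {0..1} ?g"
      unfolding mu_int_def by (rule set_borel_integral_eq_integral)
    have split: "integral {0..real n / l} ?g = (\<Sum>t<n. integral {real t / l..real (Suc t) / l} ?g)" for n
    proof (induction n)
      case (Suc n)
      have "integral {0..real n / l} ?g + integral {real n / l..real (Suc n) / l} ?g = integral {0..real (Suc n) / l} ?g"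
        by (intro Henstock_Kurzweil_Integration.integral_combine int) (auto simp: divide_right_mono)
      thus ?case using Suc by simp
    qed simp
    have part: "\<bar>(1 / l) * f (Complex (\<kappa>' + real t / l) h) - integral {real t / l..real (Suc t) / l} ?g\<bar> \<le> \<eta> * (1 / l)"
      if t: "t < l" for t
    proof -
      have le: "real t / l \<le> real (Suc t) / l" by (simp add: divide_right_mono)
      have len: "real (Suc t) / l - real t / l = 1 / l" by (simp add: diff_divide_distrib[symmetric])
      have tl: "real (Suc t) / l \<le> 1" using t by (simp add: field_simps)
      let ?c = "f (Complex (\<kappa>' + real t / l) h)"
      have "norm (integral {real t / l..real (Suc t) / l} (\<lambda>x. ?c - ?g x)) \<le> \<eta> * (real (Suc t) / l - real t / l)"
      proof (rule integral_bound[OF le])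
        show "continuous_on {real t / l..real (Suc t) / l} (\<lambda>x. ?c - ?g x)"
          by (intro continuous_intros cg)
        fix x assume x: "x \<in> {real t / l..real (Suc t) / l}"
        have "0 \<le> real t / l" by simp
        have "Complex (\<kappa>' + real t / l) h \<in> ?K" using \<kappa>' tl len h \<rho> l \<open>0 \<le> real t / l\<close> unfolding K complex.sel by linarith
        moreover have "Complex x h0 \<in> ?K" using x tl h0 \<open>0 \<le> real t / l\<close> unfolding K complex.sel atLeastAtMost_iff by linarith
        moreover have "dist (Complex (\<kappa>' + real t / l) h) (Complex x h0) < d"
        proof -
          have "dist (Complex (\<kappa>' + real t / l) h) (Complex x h0) \<le> \<bar>\<kappa>' + real t / l - x\<bar> + \<bar>h - h0\<bar>"
            unfolding dist_norm using cmod_le[of "Complex (\<kappa>' + real t / l) h - Complex x h0"] by simp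
          moreover have "\<bar>\<kappa>' + real t / l - x\<bar> \<le> 1 / l" using x \<kappa>' len unfolding atLeastAtMost_iff by linarith
          ultimately show ?thesis using h \<rho> l by linarith
        qed
        ultimately have "dist (f (Complex (\<kappa>' + real t / l) h)) (f (Complex x h0)) < \<eta>" by (intro d)
        thus "norm (?c - ?g x) \<le> \<eta>" by (simp add: dist_norm)
      qed
      moreover have "integral {real t / l..real (Suc t) / l} (\<lambda>x. ?c - ?g x) =
          (1 / l) * ?c - integral {real t / l..real (Suc t) / l} ?g"
        using le len by (subst Henstock_Kurzweil_Integration.integral_diff[OF _ int]) auto
      ultimately show ?thesis using len by simp
    qed
    have "(1 / real l) * (\<Sum>t<l. f (Complex (\<kappa> + real t / l) h)) - mu_int h0 f =
      (\<Sum>t<l. (1 / l) * f (Complex (\<kappa>' + real t / l) h) - integral {real t / l..real (Suc t) / l} ?g)"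
      using split[of l] l unfolding eq mu by (simp add: sum_distrib_left sum_subtractf)
    also have "\<bar>\<dots>\<bar> \<le> (\<Sum>t<l. \<eta> * (1 / l))"
      by (intro order_trans[OF sum_abs] sum_mono part) auto
    also have "\<dots> = \<eta>" using l by simp
    finally show "\<bar>(1 / real l) * (\<Sum>t<l. f (Complex (\<kappa> + real t / real l) h)) - mu_int h0 f\<bar> \<le> \<eta>" .
  qed
qed

text \<open>This is the source of the totient weights in \<open>nu_int\<close>. As \<open>R\<close>
  is invertible modulo \<open>m\<close>, \<open>P + r R\<close> runs through all residues, and
  \<open>totient (m div d)\<close> of them have gcd \<open>d\<close> with \<open>m\<close>.\<close>

lemma sum_gcd_arith_progression:
  fixes P R :: int and m :: nat and g :: "nat \<Rightarrow> real"
  assumes m: "m > 0" and R: "coprime R (int m)"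
  shows "(\<Sum>r<m. g (nat (gcd (P + int r * R) (int m)))) = (\<Sum>d | d dvd m. real (totient (m div d)) * g d)"
proof -
  define \<pi> where "\<pi> r = nat ((P + int r * R) mod int m)" for r :: nat
  have \<pi>_less: "\<pi> r < m" for r unfolding \<pi>_def using m by (simp add: nat_less_iff)
  have inj: "inj_on \<pi> {..<m}"
  proof (rule inj_onI)
    fix r s assume rs: "r \<in> {..<m}" "s \<in> {..<m}" "\<pi> r = \<pi> s"
    hence "(P + int r * R) mod int m = (P + int s * R) mod int m"
      unfolding \<pi>_def using m by (simp add: eq_nat_nat_iff)
    hence "int m dvd (int r - int s) * R" by (simp add: mod_eq_dvd_iff algebra_simps)
    hence "int m dvd int r - int s" using R by (metis coprime_commute coprime_dvd_mult_left_iff)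
    hence "[int r = int s] (mod int m)" by (simp add: cong_iff_dvd_diff)
    thus "r = s" using rs by (auto simp: cong_int_iff cong_less_modulus_unique_nat)
  qed
  have "\<pi> ` {..<m} = {..<m}"
    using \<pi>_less inj by (intro card_subset_eq) (auto simp: card_image)
  hence bij: "bij_betw \<pi> {..<m} {..<m}" using inj by (simp add: bij_betw_def)
  have gcd_\<pi>: "nat (gcd (P + int r * R) (int m)) = gcd (\<pi> r) m" for r
  proof -
    have "int (gcd (\<pi> r) m) = gcd ((P + int r * R) mod int m) (int m)"
      unfolding \<pi>_def using m by (simp add: gcd_int_int_eq[symmetric])
    also have "\<dots> = gcd (P + int r * R) (int m)"
      by (metis gcd.commute gcd_red_int)
    finally show ?thesis by (metis nat_int)
  qed
  have "(\<Sum>r<m. g (nat (gcd (P + int r * R) (int m)))) = (\<Sum>r<m. g (gcd (\<pi> r) m))"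
    by (simp add: gcd_\<pi>)
  also have "\<dots> = (\<Sum>k<m. g (gcd k m))"
    by (rule sum.reindex_bij_betw[OF bij, of "\<lambda>k. g (gcd k m)"])
  \<comment> \<open>The residue 0 is traded for \<open>m\<close>, which has the same gcd with
    \<open>m\<close>, to match the range in \<open>card_gcd_eq_totient\<close>.\<close>
  also have "\<dots> = (\<Sum>k\<in>{0<..m}. g (gcd k m))"
    by (rule sum.reindex_bij_witness[of _ "\<lambda>k. if k = m then 0 else k" "\<lambda>k. if k = 0 then m else k"])
      (use m in auto)
  also have "\<dots> = (\<Sum>d\<in>{d. d dvd m}. \<Sum>k\<in>{k\<in>{0<..m}. gcd k m = d}. g (gcd k m))"
    using m by (intro sum.group[symmetric]) auto
  also have "\<dots> = (\<Sum>d | d dvd m. real (totient (m div d)) * g d)"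
  proof (rule sum.cong)
    fix d assume d: "d \<in> {d. d dvd m}"
    have "(\<Sum>k\<in>{k\<in>{0<..m}. gcd k m = d}. g (gcd k m)) = (\<Sum>k\<in>{k\<in>{0<..m}. gcd k m = d}. g d)"
      by (rule sum.cong) auto
    thus "(\<Sum>k\<in>{k\<in>{0<..m}. gcd k m = d}. g (gcd k m)) = real (totient (m div d)) * g d"
      using card_gcd_eq_totient[of m d] d m by simp
  qed simp
  finally show ?thesis .
qed

text \<open>With \<open>u = n R x - P\<close>, the modular map that sends \<open>P / (R n)\<close> to infinity sends \<open>x + iy\<close> to
  height \<open>y / (u\<^sup>2 + (R n y)\<^sup>2)\<close>; the inequalities keep this within a factor \<open>1 + O(\<epsilon>)\<close> of \<open>Y\<close>.\<close>
definition near_cusps :: "real \<Rightarrow> nat \<Rightarrow> real \<Rightarrow> real \<Rightarrow> real set" where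
  "near_cusps Y n \<epsilon> y = {x. \<exists>P R :: int. 1 \<le> R \<and> coprime P R \<and> coprime R (int n) \<and>
     of_int R * real n * sqrt (y * Y) \<le> \<epsilon> \<and>
     sqrt (y / Y) * (1 - \<epsilon>) \<le> real n * of_int R * x - of_int P \<and>
     real n * of_int R * x - of_int P \<le> sqrt (y / Y)}"

text \<open>The denominator lies between \<open>(1 - \<epsilon>)^2\<close> and
  \<open>1 + \<epsilon>^2\<close> times \<open>y / Y\<close>: \<open>u^2\<close> is within a factor
  \<open>(1 - \<epsilon>)^2\<close> below \<open>y / Y\<close>, and \<open>v^2 y^2\<close> adds at
  most \<open>\<epsilon>^2\<close> times \<open>y / Y\<close>.\<close>

lemma near_cusps_height:
  fixes Y y \<epsilon> u v :: real
  assumes "Y > 0" "y > 0" "0 < \<epsilon>" "\<epsilon> \<le> 1 / 2"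
    and v: "0 \<le> v" "v * sqrt (y * Y) \<le> \<epsilon>"
    and u: "sqrt (y / Y) * (1 - \<epsilon>) \<le> u" "u \<le> sqrt (y / Y)"
  shows "\<bar>y / (u\<^sup>2 + v\<^sup>2 * y\<^sup>2) - Y\<bar> \<le> 8 * \<epsilon> * Y"
proof -
  have sq: "(sqrt (y / Y))\<^sup>2 = y / Y" "(sqrt (y * Y))\<^sup>2 = y * Y" using assms by simp_all
  have s0: "sqrt (y / Y) > 0" using assms by simp
  have u0: "0 \<le> sqrt (y / Y) * (1 - \<epsilon>)" using assms s0 by simp
  have "(sqrt (y / Y) * (1 - \<epsilon>))\<^sup>2 \<le> u\<^sup>2" using u u0 by (intro power_mono) auto
  hence lo: "(y / Y) * (1 - \<epsilon>)\<^sup>2 \<le> u\<^sup>2" by (simp add: power_mult_distrib sq)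
  have "u\<^sup>2 \<le> (sqrt (y / Y))\<^sup>2" using u u0 by (intro power_mono) auto
  hence hi: "u\<^sup>2 \<le> y / Y" by (simp add: sq)
  have "(v * sqrt (y * Y))\<^sup>2 \<le> \<epsilon>\<^sup>2" using v assms by (intro power_mono) auto
  hence "v\<^sup>2 * (y * Y) \<le> \<epsilon>\<^sup>2" by (simp add: power_mult_distrib sq)
  hence "v\<^sup>2 * (y * Y) * (y / Y) \<le> \<epsilon>\<^sup>2 * (y / Y)" using assms by (intro mult_right_mono) auto
  hence v2: "v\<^sup>2 * y\<^sup>2 \<le> \<epsilon>\<^sup>2 * (y / Y)" using assms by (simp add: power2_eq_square)
  let ?D = "u\<^sup>2 + v\<^sup>2 * y\<^sup>2"
  have D1: "(y / Y) * (1 - \<epsilon>)\<^sup>2 \<le> ?D" using lo by (simp add: add_increasing2)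
  have D2: "?D \<le> (y / Y) * (1 + \<epsilon>\<^sup>2)" using hi v2 by (simp add: algebra_simps)
  have e1: "(1 - \<epsilon>)\<^sup>2 > 0" using assms by simp
  have Dpos: "?D > 0" using D1 e1 assms by (smt (verit) divide_pos_pos mult_pos_pos)
  have "y / ?D \<le> y / ((y / Y) * (1 - \<epsilon>)\<^sup>2)"
    using D1 Dpos e1 assms by (intro divide_left_mono) auto
  also have "\<dots> = Y / (1 - \<epsilon>)\<^sup>2" using assms by simp
  also have "\<dots> \<le> Y * (1 + 8 * \<epsilon>)"
  proof -
    \<comment> \<open>The constant 8 suffices up to \<open>\<epsilon> = 1 / 2\<close>; the
      factorisation below shows that the quadratic cofactor is positive there.\<close>
    have "(1 + 8 * \<epsilon>) * (1 - \<epsilon>)\<^sup>2 - 1 = \<epsilon> * (6 - 15 * \<epsilon> + 8 * \<epsilon>\<^sup>2)" by (simp add: power2_eq_square algebra_simps)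
    moreover have "6 - 15 * \<epsilon> + 8 * \<epsilon>\<^sup>2 = (1 - 2 * \<epsilon>) * (11/2 - 4 * \<epsilon>) + 1 / 2" by (simp add: power2_eq_square field_simps)
    hence "6 - 15 * \<epsilon> + 8 * \<epsilon>\<^sup>2 \<ge> 0" using assms by simp
    ultimately have "1 \<le> (1 + 8 * \<epsilon>) * (1 - \<epsilon>)\<^sup>2" using assms by (smt (verit) mult_nonneg_nonneg)
    hence "Y * 1 \<le> Y * ((1 + 8 * \<epsilon>) * (1 - \<epsilon>)\<^sup>2)" using assms by (intro mult_left_mono) auto
    thus ?thesis using e1 by (simp add: pos_divide_le_eq algebra_simps)
  qed
  finally have up: "y / ?D \<le> Y + 8 * \<epsilon> * Y" by (simp add: algebra_simps)
  have "Y - 8 * \<epsilon> * Y \<le> Y / (1 + \<epsilon>\<^sup>2)"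
  proof -
    have "(1 - 8 * \<epsilon>) * (1 + \<epsilon>\<^sup>2) = 1 - \<epsilon> * (8 - \<epsilon> + 8 * \<epsilon>\<^sup>2)" by (simp add: power2_eq_square algebra_simps)
    moreover have "0 \<le> \<epsilon> * (8 - \<epsilon> + 8 * \<epsilon>\<^sup>2)" using assms by (intro mult_nonneg_nonneg) auto
    ultimately have "(1 - 8 * \<epsilon>) * (1 + \<epsilon>\<^sup>2) \<le> 1" by linarith
    hence "Y * ((1 - 8 * \<epsilon>) * (1 + \<epsilon>\<^sup>2)) \<le> Y * 1" using assms by (intro mult_left_mono) auto
    moreover have "1 + \<epsilon>\<^sup>2 > 0" by (simp add: add_pos_nonneg)
    ultimately have "Y * (1 - 8 * \<epsilon>) \<le> Y / (1 + \<epsilon>\<^sup>2)" by (simp add: pos_le_divide_eq mult.assoc)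
    thus ?thesis by (simp add: algebra_simps)
  qed
  also have "\<dots> = y / ((y / Y) * (1 + \<epsilon>\<^sup>2))" using assms by simp
  also have "\<dots> \<le> y / ?D"
    using D2 Dpos assms by (intro divide_left_mono mult_pos_pos) (auto simp: add_pos_nonneg)
  finally have "Y - 8 * \<epsilon> * Y \<le> y / ?D" .
  with up show ?thesis by linarith
qed

lemma delta_int_split:
  "delta_int (m * l) x y f =
    (1 / real m) * (\<Sum>r<m. (1 / real l) * (\<Sum>i<l. f (Complex (x + real (r + m * i) / real (m * l)) y)))"
proof -
  let ?g = "\<lambda>j. f (Complex (x + real j / real (m * l)) y)"
  have "(\<Sum>j<m * l. ?g j) = (\<Sum>i<l. \<Sum>j\<in>{i * m..<i * m + m}. ?g j)"
    using sum.nat_group[of ?g m l] by (simp add: mult.commute)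
  also have "\<dots> = (\<Sum>i<l. \<Sum>r<m. ?g (r + m * i))"
  proof (rule sum.cong)
    fix i
    show "(\<Sum>j\<in>{i * m..<i * m + m}. ?g j) = (\<Sum>r<m. ?g (r + m * i))"
      by (rule sum.reindex_bij_witness[of _ "\<lambda>r. r + m * i" "\<lambda>j. j - m * i"]) (auto simp: mult.commute)
  qed simp
  also have "\<dots> = (\<Sum>r<m. \<Sum>i<l. ?g (r + m * i))" by (rule sum.swap)
  finally show ?thesis unfolding delta_int_def by (simp add: sum_distrib_left)
qed

text \<open>For each \<open>r\<close>, the points with \<open>j = r + m i\<close> are moved to a
  horocycle of height near \<open>d^2 Y\<close>, where \<open>d = gcd (P + r R) m\<close>, and
  compared with \<open>mu_int\<close>; averaging over \<open>r\<close> then gives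
  \<open>nu_int\<close>. The thresholds do not depend on \<open>x\<close>, \<open>y\<close> or the
  fraction, so they serve along any subsequence.\<close>

lemma delta_int_near_cusps:
  assumes f: "test_fun f" and m: "m > 0" and Y: "Y > 0" and \<eta>: "\<eta> > 0"
  obtains \<epsilon>0 n0 where "\<epsilon>0 > 0"
    "\<And>n \<epsilon> x y. \<lbrakk>n \<in> P_set m; n \<ge> n0; 0 < \<epsilon>; \<epsilon> < \<epsilon>0; y > 0; x \<in> near_cusps Y n \<epsilon> y\<rbrakk> \<Longrightarrow>
       \<bar>delta_int n x y f - nu_int m Y f\<bar> \<le> \<eta>"
proof -
  have "\<exists>C. \<forall>z. Im z > 0 \<longrightarrow> \<bar>f z\<bar> \<le> C"
    using f unfolding test_fun_def bounded_iff upper_half_def by fastforce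
  then obtain C where C: "\<And>z. Im z > 0 \<Longrightarrow> \<bar>f z\<bar> \<le> C" by blast
  have C0: "C \<ge> 0" using C[of \<i>] by simp
  have "\<exists>\<rho>>0. \<forall>l \<kappa> h. l > 0 \<longrightarrow> 1 / real l < \<rho> \<longrightarrow> \<bar>h - (real d)\<^sup>2 * Y\<bar> < \<rho> \<longrightarrow>
       \<bar>(1 / real l) * (\<Sum>t<l. f (Complex (\<kappa> + real t / real l) h)) - mu_int ((real d)\<^sup>2 * Y) f\<bar> \<le> \<eta> / 2"
    if "d > 0" for d :: nat
    using horocycle_riemann_sum[OF f, of "(real d)\<^sup>2 * Y" "\<eta> / 2"] Y \<eta> that by (metis half_gt_zero mult_pos_pos of_nat_0_less_iff zero_less_power)
  then obtain \<rho> where \<rho>: "\<And>d. d > 0 \<Longrightarrow> \<rho> d > 0"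
    "\<And>d l \<kappa> h. \<lbrakk>d > 0; l > 0; 1 / real l < \<rho> d; \<bar>h - (real d)\<^sup>2 * Y\<bar> < \<rho> d\<rbrakk> \<Longrightarrow>
       \<bar>(1 / real l) * (\<Sum>t<l. f (Complex (\<kappa> + real t / real l) h)) - mu_int ((real d)\<^sup>2 * Y) f\<bar> \<le> \<eta> / 2"
    by metis
  define \<rho>0 where "\<rho>0 = Min (\<rho> ` {1..m})"
  have \<rho>0: "\<rho>0 > 0" "\<And>d. d \<in> {1..m} \<Longrightarrow> \<rho>0 \<le> \<rho> d"
    using m \<rho>(1) unfolding \<rho>0_def by (auto simp: Min_gr_iff)
  \<comment> \<open>The height error \<open>8 \<epsilon> Y\<close> is multiplied by
    \<open>d^2 \<le> m^2\<close>, and must stay below the least tolerance \<open>\<rho>0\<close>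
    over all possible \<open>d\<close>.\<close>
  define \<epsilon>0 where "\<epsilon>0 = min (1 / 2) (\<rho>0 / (8 * (real m)\<^sup>2 * Y))"
  \<comment> \<open>With \<open>n = m l\<close>, \<open>n1\<close> ensures
    \<open>1 / l < \<rho>0\<close>, and \<open>n2\<close> makes the loss \<open>2 C / l\<close> from
    unmatched terms at most \<open>\<eta> / 2\<close>.\<close>
  obtain n1 :: nat where n1: "real n1 > real m * (1 / \<rho>0)" using reals_Archimedean2 by blast
  obtain n2 :: nat where n2: "real n2 > real m * (4 * C / \<eta>)" using reals_Archimedean2 by blast
  show ?thesis
  proof (rule that[of \<epsilon>0 "max n1 n2"])
    show "\<epsilon>0 > 0" using \<rho>0 m Y by (simp add: \<epsilon>0_def)
    fix n \<epsilon> x y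
    assume n: "n \<in> P_set m" "n \<ge> max n1 n2" and \<epsilon>: "0 < \<epsilon>" "\<epsilon> < \<epsilon>0" and y: "y > 0"
      and x: "x \<in> near_cusps Y n \<epsilon> y"
    obtain l where l: "prime l" "\<not> l dvd m" and nl: "n = m * l" using n(1) by (auto simp: P_set_def)
    have l0: "l > 0" using l prime_gt_0_nat by blast
    have "real m * real l > real m * (1 / \<rho>0)" "real m * real l > real m * (4 * C / \<eta>)"
      using n(2) n1 n2 unfolding nl by (simp_all flip: of_nat_mult)
    hence lr: "real l > 1 / \<rho>0" and l2: "real l > 4 * C / \<eta>"
      using m by (simp_all only: mult_less_cancel_left_pos of_nat_0_less_iff)
    have l1: "1 / real l < \<rho>0" using lr \<rho>0(1) l0 by (simp add: field_simps)
    have l2': "2 * C / l \<le> \<eta> / 2" using l2 \<eta> l0 by (simp add: field_simps)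
    obtain P R :: int where PR: "1 \<le> R" "coprime P R" "coprime R (int n)"
      "of_int R * real n * sqrt (y * Y) \<le> \<epsilon>"
      "sqrt (y / Y) * (1 - \<epsilon>) \<le> real n * of_int R * x - of_int P"
      "real n * of_int R * x - of_int P \<le> sqrt (y / Y)"
      using x unfolding near_cusps_def by blast
    define u where "u = real n * of_int R * x - of_int P"
    define v where "v = of_int R * real n"
    define Y' where "Y' = y / (u\<^sup>2 + v\<^sup>2 * y\<^sup>2)"
    have v0: "v > 0" using PR m l0 by (simp add: v_def nl)
    have \<epsilon>half: "\<epsilon> \<le> 1 / 2" using \<epsilon> by (simp add: \<epsilon>0_def)
    have "\<bar>Y' - Y\<bar> \<le> 8 * \<epsilon> * Y" unfolding Y'_def
      using near_cusps_height[OF Y y \<epsilon>(1) \<epsilon>half, of v u] PR v0 by (simp add: u_def v_def)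
    also have "\<dots> < \<rho>0 / (real m)\<^sup>2"
    proof -
      have "\<epsilon> < \<rho>0 / (8 * (real m)\<^sup>2 * Y)" using \<epsilon> by (simp add: \<epsilon>0_def)
      thus ?thesis using m Y by (simp add: field_simps)
    qed
    finally have Y': "(real m)\<^sup>2 * \<bar>Y' - Y\<bar> < \<rho>0" using m by (simp add: field_simps)
    define dd where "dd r = nat (gcd (P + int r * R) (int m))" for r :: nat
    have main: "\<bar>(1 / real l) * (\<Sum>i<l. f (Complex (x + real (r + m * i) / real n) y)) -
        mu_int ((real (dd r))\<^sup>2 * Y) f\<bar> \<le> \<eta>" if "r < m" for r
    proof -
      \<comment> \<open>Cancelling \<open>d\<close> in \<open>(P + r R) / (R m)\<close> leaves the
        reduced fraction \<open>a0 / B\<close>. With \<open>x = P / v + s\<close>, the sample point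
        becomes \<open>a0 / (B l) + i / l\<close> plus \<open>?w\<close>, the form required by
        \<open>sum_test_fun_to_horocycle\<close>.\<close>
      define d where "d = gcd (P + int r * R) (int m)"
      have d0: "d > 0" using m by (simp add: d_def)
      define a0 where "a0 = (P + int r * R) div d"
      define M where "M = int m div d"
      define B where "B = R * M"
      define s where "s = u / v"
      let ?w = "Complex s y"
      have a0: "a0 * d = P + int r * R" and Md: "M * d = int m" by (simp_all add: a0_def M_def d_def)
      have M0: "M > 0" using Md d0 m by (metis of_nat_0_less_iff zero_less_mult_pos2)
      have B0: "B > 0" using M0 PR by (simp add: B_def)
      have "coprime (P + int r * R) R"
        using PR(2) by (metis coprime_iff_gcd_eq_1 gcd_add_mult gcd.commute add.commute)
      hence cop1: "coprime a0 R" using a0 by (metis coprime_mult_left_iff)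
      have cop2: "coprime a0 M" unfolding a0_def M_def d_def using m by (intro div_gcd_coprime) auto
      have copB: "coprime a0 B" using cop1 cop2 by (simp add: B_def)
      have lm: "coprime (int m) (int l)" using l by (simp add: prime_imp_coprime coprime_commute)
      have "coprime M (int l)" using lm Md by (metis coprime_mult_left_iff)
      moreover have "coprime R (int l)" using PR(3) nl by simp
      ultimately have copl: "coprime B (int l)" by (simp add: B_def)
      have dM: "real_of_int d * real_of_int M = real m" using Md by (metis mult.commute of_int_mult of_int_of_nat_eq)
      have vB: "v = of_int d * (of_int B * real l)"
        by (simp add: v_def B_def nl dM[symmetric])
      have xs: "x = of_int P / v + s" using PR(1) m l0 by (simp add: s_def u_def v_def nl add_divide_distrib[symmetric] mult.commute)
      have "real n \<noteq> 0" "real_of_int R \<noteq> 0" using m l0 PR by (simp_all add: nl)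
      have pt: "Complex (x + real (r + m * i) / real n) y =
          of_real (of_int a0 / (of_int B * real l) + real i / real l) + ?w" for i
      proof -
        have "of_int a0 / (of_int B * real l) = (of_int a0 * of_int d) / v"
          unfolding vB using d0 by simp
        also have "of_int a0 * of_int d = of_int P + real r * of_int R"
          using a0 by (metis of_int_add of_int_mult of_int_of_nat_eq)
        also have "(of_int P + real r * of_int R) / v = of_int P / v + real r / real n"
          unfolding v_def using \<open>real n \<noteq> 0\<close> \<open>real_of_int R \<noteq> 0\<close> by (simp add: field_simps)
        finally have 1: "of_int a0 / (of_int B * real l) = of_int P / v + real r / real n" .
        have 2: "real (m * i) / real n = real i / real l" using m l0 by (simp add: nl)
        show ?thesis unfolding complex_eq_iff using xs 1 2 by (simp add: add_divide_distrib)
      qed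
      \<comment> \<open>The denominator is \<open>B l = v / d\<close>, so cancelling
        \<open>d\<close> raises the height \<open>Y'\<close> by the factor
        \<open>d^2\<close>.\<close>
      have ht: "Im ?w / ((of_int B * real l)\<^sup>2 * (cmod ?w)\<^sup>2) = (real (dd r))\<^sup>2 * Y'"
      proof -
        have ddr: "real (dd r) = of_int d" unfolding dd_def d_def by simp
        have bl: "of_int B * real l = v / of_int d" using vB d0 by simp
        have "v\<^sup>2 * (cmod ?w)\<^sup>2 = u\<^sup>2 + v\<^sup>2 * y\<^sup>2"
          unfolding cmod_power2 s_def using v0 by (simp add: field_simps)
        thus ?thesis unfolding bl ddr Y'_def by (simp add: power_divide)
      qed
      obtain \<kappa> where \<kappa>: "\<bar>(\<Sum>i<l. f (Complex (x + real (r + m * i) / real n) y)) -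
        (\<Sum>t<l. f (Complex (\<kappa> + real t / real l) ((real (dd r))\<^sup>2 * Y')))\<bar> \<le> 2 * C"
        using sum_test_fun_to_horocycle[OF f l(1) B0 copB copl, of ?w C] y C unfolding pt ht[symmetric]
        by (metis complex.sel(2))
      have ddm: "dd r \<in> {1..m}"
      proof -
        have "dd r dvd m" unfolding dd_def by (metis gcd_dvd2 gcd_ge_0_int int_dvd_int_iff nat_0_le)
        thus ?thesis using m by (auto dest: dvd_imp_le intro!: Suc_leI intro: dvd_pos_nat)
      qed
      have "\<bar>(real (dd r))\<^sup>2 * Y' - (real (dd r))\<^sup>2 * Y\<bar> = (real (dd r))\<^sup>2 * \<bar>Y' - Y\<bar>"
        by (simp add: right_diff_distrib[symmetric] abs_mult)
      also have "\<dots> \<le> (real m)\<^sup>2 * \<bar>Y' - Y\<bar>" using ddm by (intro mult_right_mono power_mono) auto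
      finally have "\<bar>(1 / real l) * (\<Sum>t<l. f (Complex (\<kappa> + real t / real l) ((real (dd r))\<^sup>2 * Y'))) -
          mu_int ((real (dd r))\<^sup>2 * Y) f\<bar> \<le> \<eta> / 2"
        using Y' \<rho>0(2)[OF ddm] l1 l0 ddm by (intro \<rho>(2)) auto
      moreover have "\<bar>(1 / real l) * (\<Sum>i<l. f (Complex (x + real (r + m * i) / real n) y)) -
        (1 / real l) * (\<Sum>t<l. f (Complex (\<kappa> + real t / real l) ((real (dd r))\<^sup>2 * Y')))\<bar> \<le> (1 / real l) * (2 * C)"
        unfolding right_diff_distrib[symmetric] abs_mult using \<kappa> by (intro mult_mono) auto
      moreover have "\<bar>a - c\<bar> \<le> \<eta>" if "\<bar>b - c\<bar> \<le> \<eta> / 2" "\<bar>a - b\<bar> \<le> (1 / real l) * (2 * C)" for a b c :: real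
      proof -
        have "\<bar>a - b\<bar> \<le> \<eta> / 2" using that(2) l2' by simp
        thus ?thesis using that(1) by linarith
      qed
      ultimately show ?thesis by blast
    qed
    have nu: "nu_int m Y f = (1 / real m) * (\<Sum>r<m. mu_int ((real (dd r))\<^sup>2 * Y) f)"
      unfolding nu_int_def dd_def
      using sum_gcd_arith_progression[OF m, of R "\<lambda>d. mu_int ((real d)\<^sup>2 * Y) f" P] PR(3) nl by simp
    have "delta_int n x y f - nu_int m Y f = (1 / real m) *
      (\<Sum>r<m. (1 / real l) * (\<Sum>i<l. f (Complex (x + real (r + m * i) / real n) y)) - mu_int ((real (dd r))\<^sup>2 * Y) f)"
      unfolding nu nl delta_int_split by (simp add: sum_subtractf right_diff_distrib)
    also have "\<bar>\<dots>\<bar> \<le> (1 / real m) * (\<Sum>r<m. \<eta>)"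
      unfolding abs_mult using main by (intro mult_mono order_trans[OF sum_abs] sum_mono) auto
    also have "\<dots> = \<eta>" using m by simp
    finally show "\<bar>delta_int n x y f - nu_int m Y f\<bar> \<le> \<eta>" .
  qed
qed

section \<open>Measure of the set of good translates\<close>

lemma harm_over_n_tendsto_0: "(\<lambda>n. harm n / real n) \<longlonglongrightarrow> 0"
proof -
  have "(\<lambda>n. (harm n - ln (real n)) * (1 / real n) + ln (real n) / real n) \<longlonglongrightarrow> euler_mascheroni * 0 + 0"
    by (intro tendsto_intros euler_mascheroni_LIMSEQ lim_1_over_n lim_ln_over_n)
  thus ?thesis by (simp add: diff_divide_distrib)
qed

lemma finite_fractions_in_interval:
  fixes u v :: real and K :: int
  shows "finite {(P :: int, R :: int). 1 \<le> R \<and> R \<le> K \<and> u \<le> of_int P / of_int R \<and> of_int P / of_int R \<le> v}"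
proof (rule finite_subset)
  let ?W = "\<lceil>(\<bar>u\<bar> + \<bar>v\<bar>) * of_int K\<rceil>"
  show "finite ({- ?W..?W} \<times> {1..K})" by simp
  show "{(P :: int, R :: int). 1 \<le> R \<and> R \<le> K \<and> u \<le> of_int P / of_int R \<and> of_int P / of_int R \<le> v}
    \<subseteq> {- ?W..?W} \<times> {1..K}"
  proof clarify
    fix P R :: int assume R: "1 \<le> R" "R \<le> K" and *: "u \<le> of_int P / of_int R" "of_int P / of_int R \<le> v"
    have "\<bar>of_int P / of_int R\<bar> \<le> \<bar>u\<bar> + \<bar>v\<bar>" using * by linarith
    hence "\<bar>of_int P\<bar> \<le> (\<bar>u\<bar> + \<bar>v\<bar>) * of_int R" using R by (simp add: abs_divide field_simps)
    also have "\<dots> \<le> (\<bar>u\<bar> + \<bar>v\<bar>) * of_int K" using R by (intro mult_left_mono) auto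
    finally have "\<bar>P\<bar> \<le> ?W" by linarith
    thus "P \<in> {- ?W..?W} \<and> R \<in> {1..K}" using R by auto
  qed
qed

lemma measure_le_sum_radii:
  fixes S :: "real set" and c r :: "'a \<Rightarrow> real"
  assumes "finite I" "S \<in> lmeasurable" "\<And>i. i \<in> I \<Longrightarrow> r i \<ge> 0" "S \<subseteq> (\<Union>i\<in>I. {c i - r i..c i + r i})"
  shows "measure lebesgue S \<le> (\<Sum>i\<in>I. 2 * r i)"
proof -
  have lm: "(\<Union>i\<in>I. {c i - r i..c i + r i}) \<in> lmeasurable"
    using assms(1) by (intro fmeasurable.finite_UN) auto
  have "measure lebesgue S \<le> measure lebesgue (\<Union>i\<in>I. {c i - r i..c i + r i})"
    using assms lm by (intro measure_mono_fmeasurable) auto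
  also have "\<dots> \<le> (\<Sum>i\<in>I. measure lebesgue {c i - r i..c i + r i})"
    using assms(1) by (intro measure_UNION_le) auto
  also have "\<dots> = (\<Sum>i\<in>I. 2 * r i)" using assms(3) by (intro sum.cong) auto
  finally show ?thesis .
qed

lemma card_int_interval_le:
  fixes a b :: real
  assumes "a \<le> b"
  shows "finite {h::int. a \<le> h \<and> h \<le> b}" "real (card {h::int. a \<le> h \<and> h \<le> b}) \<le> b - a + 1"
proof -
  have eq: "{h::int. a \<le> h \<and> h \<le> b} = {\<lceil>a\<rceil>..\<lfloor>b\<rfloor>}" by (auto simp: ceiling_le_iff le_floor_iff)
  show "finite {h::int. a \<le> h \<and> h \<le> b}" unfolding eq by simp
  have "real (nat (\<lfloor>b\<rfloor> - \<lceil>a\<rceil> + 1)) \<le> b - a + 1" using assms by linarith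
  thus "real (card {h::int. a \<le> h \<and> h \<le> b}) \<le> b - a + 1" unfolding eq by simp
qed

text \<open>Apply Dirichlet's theorem to every point of the interval. Points whose approximation has
  denominator below \<open>N / 16\<close> fill only a small part of the interval; all the others are close to an
  admissible fraction, so the admissible neighbourhoods cover at least half of the interval.\<close>
lemma sum_inverse_denominators_ge:
  fixes u v :: real and m l :: nat
  assumes m: "m > 0" and l: "prime l" "\<not> l dvd m" and uv: "u < v"
  shows "\<forall>\<^sub>F N in sequentially. (v - u) * real N / (4 * (17 + 2 * real m)) \<le>
    (\<Sum>(P, R) \<in> {(P :: int, R :: int). 1 \<le> R \<and> R \<le> 3 * int m * int N \<and> coprime P R \<and>
        coprime R (int (m * l)) \<and> u \<le> of_int P / of_int R \<and> of_int P / of_int R \<le> v}. 1 / of_int R)"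
proof -
  define L where "L = v - u"
  define C where "C = 17 + 2 * real m"
  have L: "L > 0" using uv by (simp add: L_def)
  have C: "C > 0" by (simp add: C_def add_pos_nonneg)
  have "\<forall>\<^sub>F N in sequentially. harm N / real N < L / 48"
    using harm_over_n_tendsto_0 L by (intro order_tendstoD) auto
  moreover have "\<forall>\<^sub>F N in sequentially. C / real N < L / 8"
    using tendsto_mult[OF tendsto_const[of C] lim_1_over_n] L
    by (intro order_tendstoD(2)[of "\<lambda>N. C / real N" 0]) auto
  moreover have "\<forall>\<^sub>F N in sequentially. N > (0::nat)" by (rule eventually_gt_at_top)
  ultimately show ?thesis
  proof eventually_elim
    case (elim N)
    define F where "F = {(P :: int, R :: int). 1 \<le> R \<and> R \<le> 3 * int m * int N \<and> coprime P R \<and>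
        coprime R (int (m * l)) \<and> u \<le> of_int P / of_int R \<and> of_int P / of_int R \<le> v}"
    have finF: "finite F"
      by (rule finite_subset[OF _ finite_fractions_in_interval[of "3 * int m * int N" u v]]) (auto simp: F_def)
    \<comment> \<open>Denominators with \<open>16 k < N\<close>, too small for
      \<open>exists_good_approximation\<close>, satisfy \<open>k \<le> K\<close>. \<open>H k\<close>
      contains every numerator Dirichlet's theorem can give for a point between \<open>u\<close> and
      \<open>v\<close>, the error being at most 1.\<close>
    define K where "K = N div 16"
    define H where "H k = {h::int. u * real k - 1 \<le> h \<and> h \<le> v * real k + 1}" for k :: nat
    define E where "E = (SIGMA k:{1..K}. H k)"
    have HH: "finite (H k)" "real (card (H k)) \<le> L * real k + 3" for k
    proof -
      have "u * real k \<le> v * real k" using uv by (intro mult_right_mono) auto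
      hence *: "u * real k - 1 \<le> v * real k + 1" by linarith
      show "finite (H k)" unfolding H_def by (rule card_int_interval_le[OF *])
      show "real (card (H k)) \<le> L * real k + 3" unfolding H_def
        using card_int_interval_le(2)[OF *] by (simp add: L_def algebra_simps)
    qed
    have finE: "finite E" using HH by (auto simp: E_def)
    \<comment> \<open>The margin \<open>L / 8\<close> exceeds the error \<open>C / N\<close>, so the
      fractions near points of \<open>J\<close> stay between \<open>u\<close> and
      \<open>v\<close>.\<close>
    define J where "J = {u + L / 8..v - L / 8}"
    let ?I = "E <+> F"
    let ?c = "case_sum (\<lambda>(k, h). of_int h / real k) (\<lambda>(P, R). of_int P / of_int R :: real)"
    let ?r = "case_sum (\<lambda>(k, h). 1 / (real k * real N)) (\<lambda>(P, R). C / (real N * of_int R))"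
    have cover: "J \<subseteq> (\<Union>i\<in>?I. {?c i - ?r i..?c i + ?r i})"
    proof
      fix \<alpha> assume \<alpha>: "\<alpha> \<in> J"
      have \<alpha>uv: "u \<le> \<alpha>" "\<alpha> \<le> v" using \<alpha> L by (auto simp: J_def)
      obtain h k where hk: "coprime h k" "0 < k" "k \<le> int N" "\<bar>of_int k * \<alpha> - of_int h\<bar> < 1/N"
        using Dirichlet_approx_coprime[OF elim(3)] by blast
      have N1: "1 / real N \<le> 1" using elim by simp
      show "\<alpha> \<in> (\<Union>i\<in>?I. {?c i - ?r i..?c i + ?r i})"
      proof (cases "real N \<le> 16 * k")
        case True
        obtain P R where PR: "coprime P R" "coprime R (int (m * l))" "1 \<le> R" "R \<le> 3 * int m * int N"
          "\<bar>of_int R * \<alpha> - of_int P\<bar> \<le> C / N"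
          using exists_good_approximation[OF m l elim(3) hk(1-3) less_imp_le[OF hk(4)] True] unfolding C_def by blast
        have R0: "real_of_int R \<ge> 1" using PR by simp
        have "of_int R * \<alpha> - of_int P = of_int R * (\<alpha> - of_int P / of_int R)" using R0 by (simp add: right_diff_distrib)
        hence "of_int R * \<bar>\<alpha> - of_int P / of_int R\<bar> \<le> C / N" using PR R0 by (simp add: abs_mult)
        hence d: "\<bar>\<alpha> - of_int P / of_int R\<bar> \<le> C / (real N * of_int R)"
          using R0 by (simp add: field_simps)
        also have "\<dots> \<le> C / real N" using R0 C elim by (simp add: field_simps)
        finally have "\<bar>\<alpha> - of_int P / of_int R\<bar> < L / 8" using elim by linarith
        hence "u \<le> of_int P / of_int R" "of_int P / of_int R \<le> v"
          using \<alpha> unfolding J_def atLeastAtMost_iff by linarith+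
        hence "(P, R) \<in> F" using PR unfolding F_def by blast
        thus ?thesis using d by (intro UN_I[of "Inr (P, R)"]) (auto simp: abs_le_iff)
      next
        case False
        define k' where "k' = nat k"
        have kk: "k = int k'" using hk by (simp add: k'_def)
        have "16 * k' < N" using False unfolding kk by linarith
        hence "k' \<le> K" unfolding K_def by linarith
        moreover have "1 \<le> k'" using hk(2) unfolding kk by linarith
        ultimately have k'K: "k' \<in> {1..K}" by simp
        have k1: "real k' \<ge> 1" using k'K by simp
        have "u * real k' \<le> real k' * \<alpha>" "real k' * \<alpha> \<le> v * real k'" using \<alpha>uv by (simp_all add: mult.commute[of _ "real k'"] mult_left_mono)
        moreover have "\<bar>real k' * \<alpha> - of_int h\<bar> \<le> 1" using hk(4) N1 unfolding kk by simp
        ultimately have "u * real k' - 1 \<le> of_int h" "of_int h \<le> v * real k' + 1" by linarith+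
        hence "h \<in> H k'" unfolding H_def by simp
        moreover have "\<bar>\<alpha> - of_int h / real k'\<bar> \<le> 1 / (real k' * real N)"
        proof -
          have "of_int k * \<alpha> - of_int h = real k' * (\<alpha> - of_int h / real k')" using k1 by (simp add: kk right_diff_distrib)
          hence "real k' * \<bar>\<alpha> - of_int h / real k'\<bar> \<le> 1 / N" using hk k1 by (simp add: abs_mult)
          thus ?thesis using k1 by (simp add: field_simps)
        qed
        ultimately show ?thesis using k'K
          by (intro UN_I[of "Inl (k', h)"]) (auto simp: abs_le_iff E_def)
      qed
    qed
    have "measure lebesgue J = 3 * L / 4"
    proof -
      have "u + L / 8 \<le> v - L / 8" "v - L / 8 - (u + L / 8) = 3 * L / 4" using L L_def by linarith+
      thus ?thesis by (simp add: J_def)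
    qed
    moreover have "measure lebesgue J \<le> (\<Sum>i\<in>?I. 2 * ?r i)"
    proof (rule measure_le_sum_radii[where c = ?c and r = ?r])
      show "J \<subseteq> (\<Union>i\<in>?I. {?c i - ?r i..?c i + ?r i})" by (rule cover)
      show "J \<in> lmeasurable" unfolding J_def by (rule lmeasurable_interval)
      show "?r i \<ge> 0" if "i \<in> ?I" for i using that C by (auto simp: F_def)
    qed (use finE finF in auto)
    moreover have "(\<Sum>i\<in>?I. 2 * ?r i) = (\<Sum>(k, h)\<in>E. 2 / (real k * real N)) + (\<Sum>(P, R)\<in>F. 2 * C / (real N * of_int R))"
      using finE finF by (simp add: sum.Plus case_prod_unfold)
    \<comment> \<open>For each \<open>k\<close> there are at most \<open>L k + 3\<close> intervals
      of length \<open>2 / (k N)\<close>. As \<open>K \<le> N / 16\<close>, the main terms total at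
      most \<open>L / 8\<close>, and so do the harmonic ones. Of the length \<open>3 L / 4\<close>
      of \<open>J\<close>, at least \<open>L / 2\<close> is left to \<open>F\<close>.\<close>
    moreover have "(\<Sum>(k, h)\<in>E. 2 / (real k * real N)) \<le> L / 4"
    proof -
      have "(\<Sum>(k, h)\<in>E. 2 / (real k * real N)) = (\<Sum>k=1..K. \<Sum>h\<in>H k. 2 / (real k * real N))"
        unfolding E_def by (rule sum.Sigma[symmetric]) (use HH in auto)
      also have "\<dots> \<le> (\<Sum>k=1..K. 2 * L / real N + 6 / real N * inverse (real k))"
      proof (rule sum_mono)
        fix k assume k: "k \<in> {1..K}"
        have "(\<Sum>h\<in>H k. 2 / (real k * real N)) = real (card (H k)) * (2 / (real k * real N))" by simp
        also have "\<dots> \<le> (L * real k + 3) * (2 / (real k * real N))" using HH by (intro mult_right_mono) auto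
        also have "\<dots> = 2 * L / real N + 6 / real N * inverse (real k)" using k elim by (simp add: field_simps)
        finally show "(\<Sum>h\<in>H k. 2 / (real k * real N)) \<le> 2 * L / real N + 6 / real N * inverse (real k)" .
      qed
      also have "\<dots> = real K * (2 * L / real N) + 6 / real N * harm K"
        by (simp add: sum.distrib sum_distrib_left harm_def)
      also have "\<dots> \<le> L / 8 + 6 * (harm N / real N)"
      proof (intro add_mono)
        have "real K * 16 \<le> real N" unfolding K_def by linarith
        thus "real K * (2 * L / real N) \<le> L / 8" using elim L by (simp add: field_simps)
        have "harm K \<le> (harm N :: real)" by (intro harm_mono) (simp add: K_def)
        thus "6 / real N * harm K \<le> 6 * (harm N / real N)" by (simp add: divide_right_mono)
      qed
      also have "\<dots> \<le> L / 4" using elim by linarith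
      finally show ?thesis .
    qed
    moreover have "(\<Sum>(P, R)\<in>F. 2 * C / (real N * of_int R)) = 2 * C / real N * (\<Sum>(P, R)\<in>F. 1 / of_int R)"
      unfolding sum_distrib_left by (intro sum.cong) auto
    ultimately have "L / 2 \<le> 2 * C / real N * (\<Sum>(P, R)\<in>F. 1 / of_int R)" by linarith
    hence "L * real N / (4 * C) \<le> (\<Sum>(P, R)\<in>F. 1 / of_int R)"
      using C elim by (simp add: field_simps)
    thus ?case unfolding F_def L_def C_def .
  qed
qed

lemma near_cusps_measurable: "near_cusps Y n \<epsilon> y \<in> sets lebesgue"
proof -
  define Q where "Q = {(P :: int, R :: int). 1 \<le> R \<and> coprime P R \<and> coprime R (int n) \<and>
     of_int R * real n * sqrt (y * Y) \<le> \<epsilon>}"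
  define T where "T PR = {x. sqrt (y / Y) * (1 - \<epsilon>) \<le> real n * of_int (snd PR) * x - of_int (fst PR) \<and>
     real n * of_int (snd PR) * x - of_int (fst PR) \<le> sqrt (y / Y)}" for PR :: "int \<times> int"
  have "near_cusps Y n \<epsilon> y = (\<Union>PR\<in>Q. T PR)"
    unfolding near_cusps_def Q_def T_def by (auto; blast)
  moreover have "closed (T PR)" for PR
    unfolding T_def by (intro closed_Collect_conj closed_Collect_le continuous_intros)
  hence "T PR \<in> sets lebesgue" for PR by (simp add: borel_closed)
  ultimately show ?thesis by (auto intro!: sets.countable_UN')
qed

text \<open>For small \<open>y\<close> the set contains disjoint intervals of length
  \<open>\<epsilon> sqrt (y / Y) / (n R)\<close>, one for each admissible \<open>P / R\<close>, and
  \<open>sum_inverse_denominators_ge\<close> bounds their total. The bound is free of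
  \<open>y\<close> and decays only like \<open>1 / n\<close>, so it is not summable over
  \<open>P_set m\<close>.\<close>

lemma near_cusps_interval_measure:
  fixes m l :: nat and Y \<epsilon> a b :: real
  assumes m: "m > 0" and l: "prime l" "\<not> l dvd m" and n: "n = m * l"
    and Y: "Y > 0" "real n * Y \<ge> 1" and \<epsilon>: "0 < \<epsilon>" "\<epsilon> \<le> 1 / 2" and ab: "a < b"
  shows "\<forall>\<^sub>F y in at_right 0. \<epsilon>\<^sup>2 / (48 * real m * (17 + 2 * real m) * Y * real n) * (b - a)
    \<le> measure lebesgue (near_cusps Y n \<epsilon> y \<inter> {a..b})"
proof -
  define C where "C = 17 + 2 * real m"
  have C: "C > 0" by (simp add: C_def add_pos_nonneg)
  have n0: "real n > 0" using m l n prime_gt_0_nat by simp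
  \<comment> \<open>\<open>M y\<close> is the largest \<open>R\<close> that
    \<open>near_cusps\<close> allows; \<open>N y\<close> is chosen so that the denominators up to
    \<open>3 m N\<close> obey it.\<close>
  define M where "M y = \<epsilon> / (real n * sqrt (y * Y))" for y
  define N where "N y = nat \<lfloor>M y / (3 * real m)\<rfloor>" for y
  define u where "u = real n * a"
  \<comment> \<open>Since \<open>P / R\<close> approximates \<open>n x\<close> from below, only
    fractions from the left half of the interval are used; the right half leaves room for the
    intervals around them.\<close>
  define v where "v = real n * ((a + b) / 2)"
  have uv: "u < v" using ab n0 by (simp add: u_def v_def)
  define F where "F N = {(P :: int, R :: int). 1 \<le> R \<and> R \<le> 3 * int m * int N \<and> coprime P R \<and>
        coprime R (int n) \<and> u \<le> of_int P / of_int R \<and> of_int P / of_int R \<le> v}" for N :: nat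
  have t0: "((\<lambda>y. sqrt (y * Y)) \<longlongrightarrow> 0) (at_right 0)" "((\<lambda>y. sqrt (y / Y)) \<longlongrightarrow> 0) (at_right 0)"
    using Y by (auto intro!: tendsto_eq_intros)
  have pos: "\<forall>\<^sub>F y in at_right (0::real). y > 0" by (rule eventually_at_right_less)
  have "filterlim (\<lambda>y. \<epsilon> / (3 * real m) / (real n * sqrt (y * Y))) at_top (at_right 0)"
  proof (rule LIM_at_top_divide[OF tendsto_const])
    show "((\<lambda>y. real n * sqrt (y * Y)) \<longlongrightarrow> 0) (at_right 0)" using tendsto_mult[OF tendsto_const t0(1)] by simp
    show "\<forall>\<^sub>F y in at_right 0. 0 < real n * sqrt (y * Y)" using pos by eventually_elim (use n0 Y in simp)
  qed (use m \<epsilon> in auto)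
  hence lim: "filterlim (\<lambda>y. M y / (3 * real m)) at_top (at_right 0)" unfolding M_def by (simp add: field_simps)
  hence limN: "filterlim N sequentially (at_right 0)" unfolding N_def
    by (intro filterlim_compose[OF filterlim_nat_sequentially] filterlim_compose[OF filterlim_floor_sequentially])
  have "\<forall>\<^sub>F y in at_right 0. (v - u) * real (N y) / (4 * C) \<le> (\<Sum>(P, R)\<in>F (N y). 1 / of_int R)"
    using eventually_compose_filterlim[OF sum_inverse_denominators_ge[OF m l uv] limN]
    unfolding C_def F_def n .
  moreover have "\<forall>\<^sub>F y in at_right 0. 1 \<le> M y / (3 * real m)"
    using lim unfolding filterlim_at_top by blast
  moreover have "\<forall>\<^sub>F y in at_right 0. sqrt (y / Y) < real n * (b - a) / 2"
    using t0(2) ab n0 by (intro order_tendstoD) auto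
  ultimately show ?thesis using pos
  proof eventually_elim
    case (elim y)
    define \<sigma> where "\<sigma> = sqrt (y / Y)"
    have \<sigma>0: "\<sigma> > 0" using elim Y by (simp add: \<sigma>_def)
    have s0: "sqrt (y * Y) > 0" using elim Y by simp
    \<comment> \<open>The product does not depend on \<open>y\<close>. As
      \<open>n Y \<ge> 1\<close>, it is at most \<open>\<epsilon> \<le> 1 / 2\<close>, which is what
      keeps the intervals disjoint.\<close>
    have \<sigma>M: "\<sigma> * M y = \<epsilon> / (real n * Y)"
    proof -
      have "sqrt (y / Y) * Y = sqrt (y * Y)"
        using elim Y by (simp add: real_sqrt_divide real_sqrt_mult field_simps)
      hence "\<sigma> = sqrt (y * Y) / Y" using Y by (simp add: \<sigma>_def field_simps)
      thus ?thesis using s0 n0 Y elim by (simp add: M_def)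
    qed
    have N_le: "3 * real m * real (N y) \<le> M y"
    proof -
      have "real (N y) \<le> M y / (3 * real m)" unfolding N_def using elim by linarith
      thus ?thesis using m by (simp add: field_simps)
    qed
    have N_ge: "M y / (6 * real m) \<le> real (N y)"
    proof -
      have "t / 2 \<le> real (nat \<lfloor>t\<rfloor>)" if "1 \<le> t" for t :: real
      proof -
        have "1 \<le> \<lfloor>t\<rfloor>" using that by simp
        thus ?thesis by linarith
      qed
      hence "M y / (3 * real m) / 2 \<le> real (N y)" unfolding N_def using elim by blast
      thus ?thesis by simp
    qed
    define T where "T PR = {(of_int (fst PR) + \<sigma> * (1 - \<epsilon>)) / (real n * of_int (snd PR))..
      (of_int (fst PR) + \<sigma>) / (real n * of_int (snd PR))}" for PR :: "int \<times> int"
    have T_iff: "x \<in> T (P, R) \<longleftrightarrow> of_int P + \<sigma> * (1 - \<epsilon>) \<le> real n * of_int R * x \<and> real n * of_int R * x \<le> of_int P + \<sigma>"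
      if "1 \<le> R" for x P R
      using that n0 by (simp add: T_def pos_divide_le_eq pos_le_divide_eq mult_ac)
    have finF: "finite (F (N y))"
      by (rule finite_subset[OF _ finite_fractions_in_interval[of "3 * int m * int (N y)" u v]]) (auto simp: F_def)
    have R_bd: "1 \<le> real_of_int R" "real_of_int R \<le> M y" if "(P, R) \<in> F (N y)" for P R
    proof -
      show "1 \<le> real_of_int R" using that by (simp add: F_def)
      have "R \<le> 3 * int m * int (N y)" using that by (simp add: F_def)
      hence "real_of_int R \<le> real_of_int (3 * int m * int (N y))" by (simp only: of_int_le_iff)
      hence "real_of_int R \<le> 3 * real m * real (N y)" by simp
      thus "real_of_int R \<le> M y" using N_le by linarith
    qed
    have sub: "(\<Union>PR\<in>F (N y). T PR) \<subseteq> near_cusps Y n \<epsilon> y \<inter> {a..b}"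
    proof clarify
      fix x P R assume PR: "(P, R) \<in> F (N y)" and x: "x \<in> T (P, R)"
      have R: "1 \<le> R" "1 \<le> real_of_int R" using PR by (auto simp: F_def)
      note x' = x[unfolded T_iff[OF R(1)]]
      have "of_int R * real n * sqrt (y * Y) \<le> \<epsilon>"
        using R_bd(2)[OF PR] n0 s0 by (simp add: M_def pos_le_divide_eq mult_ac)
      hence nc: "x \<in> near_cusps Y n \<epsilon> y" using PR x' unfolding near_cusps_def F_def \<sigma>_def by force
      have uP: "u * of_int R \<le> of_int P" "of_int P \<le> v * of_int R"
        using PR R by (auto simp: F_def pos_le_divide_eq pos_divide_le_eq)
      have "0 \<le> \<sigma> * (1 - \<epsilon>)" using \<sigma>0 \<epsilon> by simp
      hence "u * of_int R \<le> real n * x * of_int R" using x' uP by (simp add: mult_ac)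
      hence "u \<le> real n * x" using R by simp
      hence ax: "a \<le> x" using n0 by (simp add: u_def)
      have "\<sigma> \<le> real n * (b - a) / 2 * of_int R"
      proof -
        have "\<sigma> \<le> real n * (b - a) / 2 * 1" using elim by (simp add: \<sigma>_def)
        also have "\<dots> \<le> real n * (b - a) / 2 * of_int R" using R n0 ab by (intro mult_left_mono) auto
        finally show ?thesis .
      qed
      moreover have "real n * x * of_int R \<le> of_int P + \<sigma>" using x' by (simp add: mult_ac)
      ultimately have "real n * x * of_int R \<le> v * of_int R + real n * (b - a) / 2 * of_int R"
        using uP(2) by linarith
      hence "real n * x * of_int R \<le> (v + real n * (b - a) / 2) * of_int R"
        by (simp only: distrib_right)
      hence "real n * x \<le> v + real n * (b - a) / 2" using R by simp
      also have "\<dots> = real n * b" by (simp add: v_def field_simps)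
      finally have "x \<le> b" using n0 by simp
      thus "x \<in> near_cusps Y n \<epsilon> y \<inter> {a..b}" using nc ax by simp
    qed
    \<comment> \<open>A common point would force \<open>P' R \<le> P R' + \<sigma> R'\<close> with
      \<open>\<sigma> R' \<le> 1 / 2\<close>, although the two integers \<open>P R' < P' R\<close>
      differ by at least 1.\<close>
    have no_overlap: False if PR: "(P, R) \<in> F (N y)" "(P', R') \<in> F (N y)" and lt: "P * R' < P' * R"
      and x: "x \<in> T (P, R)" "x \<in> T (P', R')" for P R P' R' x
    proof -
      have R: "1 \<le> R" "1 \<le> R'" using PR by (auto simp: F_def)
      have x1: "real n * of_int R * x \<le> of_int P + \<sigma>" using x(1) T_iff[OF R(1)] by blast
      have "of_int P' + \<sigma> * (1 - \<epsilon>) \<le> real n * of_int R' * x" using x(2) T_iff[OF R(2)] by blast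
      hence x2: "of_int P' \<le> real n * of_int R' * x" 
      proof -
        have "0 \<le> \<sigma> * (1 - \<epsilon>)" using \<sigma>0 \<epsilon> by simp
        thus ?thesis using \<open>of_int P' + \<sigma> * (1 - \<epsilon>) \<le> real n * of_int R' * x\<close> by linarith
      qed
      have "of_int R' * (real n * of_int R * x) \<le> of_int R' * (of_int P + \<sigma>)" using x1 R by (intro mult_left_mono) auto
      moreover have "of_int R * of_int P' \<le> of_int R * (real n * of_int R' * x)" using x2 R by (intro mult_left_mono) auto
      ultimately have "of_int R * of_int P' \<le> of_int R' * of_int P + \<sigma> * (of_int R' :: real)"
        by (simp add: algebra_simps)
      moreover have "\<sigma> * of_int R' \<le> \<sigma> * M y" using R_bd(2)[OF PR(2)] \<sigma>0 by (intro mult_left_mono) auto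
      moreover have "\<sigma> * M y \<le> 1 / 2"
      proof -
        have "\<epsilon> / (real n * Y) \<le> \<epsilon> / 1" using Y \<epsilon> by (intro divide_left_mono) auto
        thus ?thesis using \<sigma>M \<epsilon> by linarith
      qed
      ultimately have "of_int R * of_int P' \<le> of_int R' * of_int P + (1 / 2 :: real)" by linarith
      moreover have "of_int (P * R') + 1 \<le> (of_int (P' * R) :: real)" using lt by linarith
      ultimately show False by (simp add: mult.commute)
    qed
    have disj: "pairwise (\<lambda>p q. disjnt (T p) (T q)) (F (N y))"
    proof (rule pairwiseI)
      fix p q assume pq: "p \<in> F (N y)" "q \<in> F (N y)" "p \<noteq> q"
      obtain P R P' R' where eqs: "p = (P, R)" "q = (P', R')" by (metis surj_pair)
      have "P * R' \<noteq> P' * R"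
      proof
        assume e: "P * R' = P' * R"
        have cop: "coprime P R" "coprime P' R'" "R > 0" "R' > 0" using pq by (auto simp: F_def eqs)
        have "R dvd R'" using e cop by (metis coprime_commute coprime_dvd_mult_right_iff dvd_triv_right)
        moreover have "R' dvd R" using e cop by (metis coprime_commute coprime_dvd_mult_right_iff dvd_triv_right)
        ultimately have "R = R'" using cop by (simp add: zdvd_antisym_nonneg)
        thus False using e cop pq(3) eqs by simp
      qed
      thus "disjnt (T p) (T q)"
        using no_overlap[of P R P' R'] no_overlap[of P' R' P R] pq eqs unfolding disjnt_iff by (metis linorder_neqE)
    qed
    have lmT: "T p \<in> lmeasurable" for p unfolding T_def by (rule lmeasurable_interval)
    have "measure lebesgue (\<Union>PR\<in>F (N y). T PR) = (\<Sum>PR\<in>F (N y). measure lebesgue (T PR))"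
      using disj finF lmT by (intro measure_UNION') auto
    also have "\<dots> = (\<Sum>(P, R)\<in>F (N y). \<sigma> * \<epsilon> / real n * (1 / of_int R))"
    proof (rule sum.cong)
      fix p assume p: "p \<in> F (N y)"
      obtain P R where PR: "p = (P, R)" by (cases p)
      have R: "1 \<le> real_of_int R" using p PR R_bd by blast
      have le: "(of_int P + \<sigma> * (1 - \<epsilon>)) / (real n * of_int R) \<le> (of_int P + \<sigma>) / (real n * of_int R)"
        using n0 R \<sigma>0 \<epsilon> by (intro divide_right_mono) (auto simp: algebra_simps)
      have "measure lebesgue (T p) = (of_int P + \<sigma>) / (real n * of_int R) - (of_int P + \<sigma> * (1 - \<epsilon>)) / (real n * of_int R)"
        unfolding T_def PR using le by simp
      also have "\<dots> = \<sigma> * \<epsilon> / real n * (1 / of_int R)"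
        unfolding diff_divide_distrib[symmetric] by (simp add: algebra_simps)
      finally show "measure lebesgue (T p) = (case p of (P, R) \<Rightarrow> \<sigma> * \<epsilon> / real n * (1 / of_int R))" by (simp add: PR)
    qed simp
    also have "\<dots> = \<sigma> * \<epsilon> / real n * (\<Sum>(P, R)\<in>F (N y). 1 / of_int R)"
      unfolding sum_distrib_left by (intro sum.cong) auto
    finally have meas: "measure lebesgue (\<Union>PR\<in>F (N y). T PR) = \<sigma> * \<epsilon> / real n * (\<Sum>(P, R)\<in>F (N y). 1 / of_int R)" .
    \<comment> \<open>48 is the product of 2 from halving the interval, 6 from \<open>N_ge\<close>
      and 4 from \<open>sum_inverse_denominators_ge\<close>.\<close>
    have "\<epsilon>\<^sup>2 / (48 * real m * C * Y * real n) * (b - a) = \<epsilon> / real n * ((v - u) * ((\<sigma> * M y) / (6 * real m)) / (4 * C))"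
      unfolding \<sigma>M u_def v_def using n0 C m Y by (simp add: field_simps power2_eq_square)
    also have "\<dots> = \<sigma> * \<epsilon> / real n * ((v - u) * (M y / (6 * real m)) / (4 * C))" by simp
    also have "\<dots> \<le> \<sigma> * \<epsilon> / real n * ((v - u) * real (N y) / (4 * C))"
      using N_ge uv C \<sigma>0 \<epsilon> n0 by (intro mult_left_mono divide_right_mono) auto
    also have "\<dots> \<le> \<sigma> * \<epsilon> / real n * (\<Sum>(P, R)\<in>F (N y). 1 / of_int R)"
      using elim \<sigma>0 \<epsilon> n0 by (intro mult_left_mono) auto
    also have "\<dots> = measure lebesgue (\<Union>PR\<in>F (N y). T PR)" by (rule meas[symmetric])
    also have "\<dots> \<le> measure lebesgue (near_cusps Y n \<epsilon> y \<inter> {a..b})"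
    proof (rule measure_mono_fmeasurable[OF sub])
      show "(\<Union>PR\<in>F (N y). T PR) \<in> sets lebesgue" using finF lmT by (intro sets.finite_UN) (auto dest: fmeasurableD)
      show "near_cusps Y n \<epsilon> y \<inter> {a..b} \<in> lmeasurable"
        using near_cusps_measurable by (subst Int_commute) (intro fmeasurable_Int_fmeasurable lmeasurable_interval)
    qed
    finally show ?case unfolding C_def .
  qed
qed

text \<open>Nonoverlapping intervals approximate \<open>S\<close> in measure, and finitely many of
  them suffice up to a small error. The proportion holds on these eventually, and half of it
  survives the errors of the approximation.\<close>

lemma eventually_measure_Int_ge:
  fixes A :: "'a \<Rightarrow> real set" and c a b :: real
  assumes A: "\<And>y. A y \<in> sets lebesgue" and c: "c \<ge> 0"
    and int: "\<And>a b. a < b \<Longrightarrow> \<forall>\<^sub>F y in G. c * (b - a) \<le> measure lebesgue (A y \<inter> {a..b})"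
    and S: "S \<in> lmeasurable" "S \<subseteq> {a..b}"
  shows "\<forall>\<^sub>F y in G. c / 2 * measure lebesgue S \<le> measure lebesgue (A y \<inter> S)"
proof (cases "c * measure lebesgue S = 0")
  case True
  thus ?thesis by (auto intro!: always_eventually)
next
  case False
  let ?\<mu> = "measure lebesgue"
  \<comment> \<open>The uncovered part costs \<open>c e\<close> and the part of the cover outside
    \<open>S\<close> costs \<open>e\<close>; this choice makes the sum exactly half of
    \<open>c\<close> times the measure of \<open>S\<close>.\<close>
  define e where "e = c / 2 * ?\<mu> S / (1 + c)"
  have cS: "c * ?\<mu> S > 0" using False c by (simp add: order_less_le)
  have e: "e > 0" using cS c by (simp add: e_def)
  have e_eq: "(1 + c) * e = c / 2 * ?\<mu> S" 
    unfolding e_def times_divide_eq_right using c by (intro nonzero_mult_div_cancel_left) simp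
  have Sab: "S \<subseteq> cbox a b" using S(2) by simp
  obtain \<D> where D: "countable \<D>" "\<And>K. K \<in> \<D> \<Longrightarrow> K \<subseteq> cbox a b \<and> K \<noteq> {} \<and> (\<exists>c d. K = cbox c d)"
    "pairwise (\<lambda>A B. interior A \<inter> interior B = {}) \<D>"
    "S \<subseteq> \<Union>\<D>" "\<Union>\<D> \<in> lmeasurable" "?\<mu> (\<Union>\<D>) \<le> ?\<mu> S + e"
    by (rule measurable_outer_intervals_bounded[OF S(1) Sab e]) blast
  have lmD: "K \<in> lmeasurable" if "K \<in> \<D>" for K using D(2)[OF that] by auto
  \<comment> \<open>Finiteness is needed because only finitely many eventual statements can be
    combined into one.\<close>
  obtain \<D>' where D': "\<D>' \<subseteq> \<D>" "finite \<D>'" "?\<mu> (\<Union>\<D>) - e < ?\<mu> (\<Union>\<D>')"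
  proof (rule measure_countable_Union_approachable[OF D(1) e lmD])
    fix D' assume "D' \<subseteq> \<D>" "finite D'"
    thus "?\<mu> (\<Union>D') \<le> ?\<mu> (\<Union>\<D>)"
      using D(5) lmD by (intro measure_mono_fmeasurable) (auto intro!: fmeasurableD fmeasurable.finite_Union)
  qed auto
  have lmU: "\<Union>\<D>' \<in> lmeasurable" using D' lmD by (intro fmeasurable.finite_Union) auto
  have "\<forall>\<^sub>F y in G. \<forall>K\<in>\<D>'. c * ?\<mu> K \<le> ?\<mu> (A y \<inter> K)"
  proof (rule eventually_ball_finite[OF D'(2)], rule ballI)
    fix K assume "K \<in> \<D>'"
    then obtain p q where K: "K = {p..q}" using D(2) D'(1) by (metis cbox_interval subsetD)
    show "\<forall>\<^sub>F y in G. c * ?\<mu> K \<le> ?\<mu> (A y \<inter> K)"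
    proof (cases "p < q")
      case True
      thus ?thesis using int[OF True] by (simp add: K)
    next
      case False
      hence "?\<mu> K = 0" by (cases "p = q") (auto simp: K)
      thus ?thesis by simp
    qed
  qed
  thus ?thesis
  proof eventually_elim
    case (elim y)
    have lmAK: "A y \<inter> K \<in> lmeasurable" if "K \<in> lmeasurable" for K
      using fmeasurable_Int_fmeasurable[OF that A] by (simp add: Int_commute)
    have neg: "negligible (K \<inter> K')" if "K \<in> \<D>'" "K' \<in> \<D>'" "K \<noteq> K'" for K K'
    proof -
      have "K \<in> \<D>" "K' \<in> \<D>" using D'(1) that by auto
      from D(2)[OF this(1)] D(2)[OF this(2)] obtain p q p' q' where KK: "K = cbox p q" "K' = cbox p' q'"
        by (elim conjE exE)
      have "\<exists>r s. K \<inter> K' = cbox r s" unfolding KK Int_interval by (intro exI) (rule refl)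
      then obtain r s where rs: "K \<inter> K' = cbox r s" by (elim exE)
      have "interior K \<inter> interior K' = {}"
        using D(3) \<open>K \<in> \<D>\<close> \<open>K' \<in> \<D>\<close> that(3) unfolding pairwise_def by blast
      hence "interior (cbox r s) = {}" by (simp only: rs[symmetric] interior_Int)
      thus ?thesis unfolding rs by (simp only: interior_cbox negligible_interval)
    qed
    have "c * (?\<mu> S - e) \<le> c * ?\<mu> (\<Union>\<D>')"
    proof -
      have "?\<mu> S \<le> ?\<mu> (\<Union>\<D>)" using D S by (intro measure_mono_fmeasurable) (auto intro: fmeasurableD)
      thus ?thesis using D'(3) c by (intro mult_left_mono) auto
    qed
    also have "?\<mu> (\<Union>\<D>') = sum ?\<mu> \<D>'"
      using D' lmD neg by (intro measure_negligible_finite_Union) (auto simp: pairwise_def)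
    also have "c * sum ?\<mu> \<D>' \<le> (\<Sum>K\<in>\<D>'. ?\<mu> (A y \<inter> K))"
      unfolding sum_distrib_left using elim by (intro sum_mono) auto
    also have "\<dots> = ?\<mu> (\<Union>K\<in>\<D>'. A y \<inter> K)"
    proof (rule measure_negligible_finite_Union_image[symmetric, OF D'(2)])
      show "A y \<inter> K \<in> lmeasurable" if "K \<in> \<D>'" for K using lmAK lmD D'(1) that by blast
      show "pairwise (\<lambda>K K'. negligible (A y \<inter> K \<inter> (A y \<inter> K'))) \<D>'"
      proof (rule pairwiseI)
        fix K K' assume "K \<in> \<D>'" "K' \<in> \<D>'" "K \<noteq> K'"
        thus "negligible (A y \<inter> K \<inter> (A y \<inter> K'))" by (intro negligible_subset[OF neg[of K K']]) auto
      qed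
    qed
    also have "\<dots> \<le> ?\<mu> ((A y \<inter> S) \<union> (\<Union>\<D> - S))"
      using D' D(5) S lmAK lmAK[OF lmU]
      by (intro measure_mono_fmeasurable) (auto intro!: fmeasurable.Un fmeasurable.Diff fmeasurableD
        sets.finite_UN dest: lmD)
    also have "\<dots> \<le> ?\<mu> (A y \<inter> S) + ?\<mu> (\<Union>\<D> - S)"
      using D(5) S lmAK by (intro measure_Un_le) (auto intro: fmeasurableD)
    also have "?\<mu> (\<Union>\<D> - S) = ?\<mu> (\<Union>\<D>) - ?\<mu> S"
      using D(4,5) S by (intro measurable_measure_Diff) (auto intro: fmeasurableD)
    finally have "c * (?\<mu> S - e) \<le> ?\<mu> (A y \<inter> S) + e" using D(6) by linarith
    thus ?case using e_eq by (simp add: algebra_simps)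
  qed
qed

section \<open>Infinitely many good translates\<close>

text \<open>A substitute for the second Borel-Cantelli lemma: instead of independence, every \<open>A n\<close> meets
  each of the sets left over by its predecessors in the expected proportion.\<close>
lemma AE_infinitely_often_of_proportions:
  fixes A :: "nat \<Rightarrow> real set" and c :: "nat \<Rightarrow> real"
  assumes A: "\<And>n. A n \<in> sets lebesgue" and I: "I \<in> lmeasurable"
    and c: "\<And>n. c n \<ge> 0" "\<not> summable c"
    and ratio: "\<And>M n. \<lbrakk>K \<le> M; M \<le> n\<rbrakk> \<Longrightarrow> c n * measure lebesgue (I - (\<Union>k\<in>{M..<n}. A k)) \<le>
      measure lebesgue (A n \<inter> (I - (\<Union>k\<in>{M..<n}. A k)))"
  shows "AE x in lebesgue. x \<in> I \<longrightarrow> infinite {n. x \<in> A n}"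
proof -
  let ?\<mu> = "measure lebesgue"
  define B where "B M n = I - (\<Union>k\<in>{M..<n}. A k)" for M n
  have B: "B M n \<in> lmeasurable" for M n
    unfolding B_def using A I by (intro fmeasurable_Diff) (auto intro!: sets.countable_UN')
  have null: "(I - (\<Union>k\<in>{M..}. A k)) \<in> null_sets lebesgue" if M: "K \<le> M" for M
  proof -
    \<comment> \<open>Each step leaves at most the proportion \<open>1 - c \<le> exp (- c)\<close>;
      divergence of the sum then drives the measure to 0.\<close>
    have bound: "?\<mu> (B M (M + j)) \<le> exp (- (\<Sum>k\<in>{M..<M + j}. c k)) * ?\<mu> I" for j
    proof (induction j)
      case 0
      show ?case by (simp add: B_def)
    next
      case (Suc j)
      have "B M (M + Suc j) = B M (M + j) - A (M + j) \<inter> B M (M + j)"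
        by (auto simp: B_def atLeastLessThanSuc)
      hence "?\<mu> (B M (M + Suc j)) = ?\<mu> (B M (M + j)) - ?\<mu> (A (M + j) \<inter> B M (M + j))"
        using B A by (simp add: measurable_measure_Diff fmeasurableD)
      also have "\<dots> \<le> ?\<mu> (B M (M + j)) - c (M + j) * ?\<mu> (B M (M + j))"
        using ratio[of M "M + j"] M unfolding B_def by simp
      also have "\<dots> = (1 + - c (M + j)) * ?\<mu> (B M (M + j))" by (simp add: algebra_simps)
      also have "\<dots> \<le> exp (- c (M + j)) * ?\<mu> (B M (M + j))"
        by (intro mult_right_mono exp_ge_add_one_self) simp
      also have "\<dots> \<le> exp (- c (M + j)) * (exp (- (\<Sum>k\<in>{M..<M + j}. c k)) * ?\<mu> I)"
        using Suc by (intro mult_left_mono) auto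
      also have "\<dots> = exp (- (\<Sum>k\<in>{M..<M + Suc j}. c k)) * ?\<mu> I"
        by (simp add: exp_add[symmetric] algebra_simps)
      finally show ?case .
    qed
    have nsum: "\<not> summable (\<lambda>j. c (j + M))" using c(2) summable_iff_shift[of c M] by blast
    have "filterlim (\<lambda>j. \<Sum>k<j. c (k + M)) at_top sequentially"
      unfolding filterlim_at_top
    proof
      fix Z :: real
      obtain j0 where j0: "Z < (\<Sum>k<j0. c (k + M))"
        using summableI_nonneg_bounded[of "\<lambda>k. c (k + M)" Z] c(1) nsum by (meson not_le)
      have "Z \<le> (\<Sum>k<j. c (k + M))" if "j0 \<le> j" for j
        using order_less_le_trans[OF j0 sum_mono2[of "{..<j}" "{..<j0}" "\<lambda>k. c (k + M)"]] that c(1) by auto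
      thus "\<forall>\<^sub>F j in sequentially. Z \<le> (\<Sum>k<j. c (k + M))" by (auto simp: eventually_sequentially)
    qed
    hence "filterlim (\<lambda>j. \<Sum>k\<in>{M..<M + j}. c k) at_top sequentially"
      by (simp add: sum.atLeastLessThan_shift_0 atLeast0LessThan add.commute)
    hence "(\<lambda>j. exp (- (\<Sum>k\<in>{M..<M + j}. c k)) * ?\<mu> I) \<longlonglongrightarrow> 0 * ?\<mu> I"
      by (intro tendsto_intros filterlim_compose[OF exp_at_bot] filterlim_compose[OF filterlim_uminus_at_bot_at_top])
    moreover have lm: "(I - (\<Union>k\<in>{M..}. A k)) \<in> lmeasurable"
      using A I by (intro fmeasurable_Diff) (auto intro!: sets.countable_UN')
    have "?\<mu> (I - (\<Union>k\<in>{M..}. A k)) \<le> exp (- (\<Sum>k\<in>{M..<M + j}. c k)) * ?\<mu> I" for j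
      using lm B by (intro order_trans[OF _ bound] measure_mono_fmeasurable) (auto simp: B_def)
    ultimately have "?\<mu> (I - (\<Union>k\<in>{M..}. A k)) \<le> 0"
      by (intro tendsto_lowerbound[of _ _ sequentially]) auto
    thus ?thesis using lm by (simp add: measure_le_0_iff flip: negligible_iff_null_sets negligible_iff_measure0)
  qed
  have "AE x in lebesgue. \<forall>M. K \<le> M \<longrightarrow> x \<notin> I - (\<Union>k\<in>{M..}. A k)"
    unfolding AE_all_countable
  proof
    fix M
    show "AE x in lebesgue. K \<le> M \<longrightarrow> x \<notin> I - (\<Union>k\<in>{M..}. A k)"
      using AE_not_in[OF null[of M]] by (cases "K \<le> M") simp_all
  qed
  thus ?thesis
  proof eventually_elim
    case (elim x)
    show ?case
    proof
      assume "x \<in> I"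
      hence "\<exists>n\<ge>M. x \<in> A n" for M using elim[rule_format, of "max K M"] by auto
      thus "infinite {n. x \<in> A n}" by (auto simp: infinite_nat_iff_unbounded_le)
    qed
  qed
qed

text \<open>Turns infinitely many hits at every fixed precision into one subsequence along which the
  precision improves.\<close>

lemma exists_diagonal_subsequence:
  fixes Q :: "nat \<Rightarrow> nat \<Rightarrow> bool"
  assumes "\<And>k. infinite {n. Q k n}"
  shows "\<exists>r :: nat \<Rightarrow> nat. strict_mono r \<and> (\<forall>k. Q k (r k))"
proof -
  have "\<exists>r. \<forall>k. Q k (r k) \<and> r k < r (Suc k)"
  proof (rule dependent_nat_choice)
    show "\<exists>x. Q 0 x" using assms[of 0] by (metis (mono_tags) finite.emptyI empty_Collect_eq)
    show "\<exists>y. Q (Suc k) y \<and> x < y" for x k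
      using assms[of "Suc k"] by (auto simp: infinite_nat_iff_unbounded)
  qed
  thus ?thesis by (auto simp: strict_mono_Suc_iff)
qed

text \<open>A prime \<open>l > m\<close> cannot divide \<open>m\<close>, so along
  \<open>n = m l\<close> the terms are eventually those of the prime series divided by
  \<open>m\<close>.\<close>

lemma not_summable_inverse_P_set:
  assumes "m > 0"
  shows "\<not> summable (\<lambda>n. if n \<in> P_set m then 1 / real n else 0)" (is "\<not> summable ?g")
proof
  assume "summable ?g"
  hence "summable (?g \<circ> (\<lambda>l. m * l))"
    by (rule summable_reindex) (use assms in \<open>auto simp: inj_on_def\<close>)
  hence "summable (\<lambda>l. real m * (?g \<circ> (\<lambda>l. m * l)) l)" by (rule summable_mult)
  moreover have "\<forall>\<^sub>F l in sequentially. real m * (?g \<circ> (\<lambda>l. m * l)) l = (if prime l then 1 / real l else 0)"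
    using eventually_gt_at_top[of m]
  proof eventually_elim
    case (elim l)
    have "\<not> l dvd m" using elim assms by (auto dest: dvd_imp_le)
    hence "m * l \<in> P_set m \<longleftrightarrow> prime l" using assms by (auto simp: P_set_def)
    thus ?case using assms elim by simp
  qed
  ultimately have "summable (\<lambda>l::nat. if prime l then 1 / real l else 0)"
    by (simp only: summable_cong)
  thus False using not_summable_inverse_primes by simp
qed

theorem theorem1p7:
  fixes m :: nat and Y :: real and c :: "nat \<Rightarrow> real"
  assumes "Y > 0" and "real m ^ 2 * Y > 1"
    and "\<forall>n\<in>P_set m. c n > 0"
  shows "\<exists>y :: nat \<Rightarrow> real. (\<forall>n\<in>P_set m. 0 < y n \<and> y n < c n) \<and>
    (AE x in lborel. x \<in> {0..<1} \<longrightarrow>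
      (\<exists>r :: nat \<Rightarrow> nat. strict_mono r \<and> (\<forall>k. r k \<in> P_set m) \<and>
         (\<forall>f. test_fun f \<longrightarrow>
            (\<lambda>k. delta_int (r k) x (y (r k)) f) \<longlonglongrightarrow> nu_int m Y f)))"
proof -
  let ?\<mu> = "measure lebesgue"
  have m: "m > 0" using assms(2) by (cases m) auto
  \<comment> \<open>The precisions tend to 0 and start at \<open>1 / 2\<close>, the largest value
    \<open>near_cusps_interval_measure\<close> admits.\<close>
  define \<epsilon> where "\<epsilon> K = 1 / (real K + 2)" for K :: nat
  have \<epsilon>: "0 < \<epsilon> K" "\<epsilon> K \<le> 1 / 2" for K by (simp_all add: \<epsilon>_def field_simps)
  \<comment> \<open>The condition \<open>n Y \<ge> 1\<close>, needed for disjoint intervals,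
    excludes only finitely many \<open>n\<close>.\<close>
  define good where "good n \<longleftrightarrow> n \<in> P_set m \<and> real n * Y \<ge> 1" for n
  define A where "A y K n = (if good n then near_cusps Y n (\<epsilon> K) (y n) else {})" for y :: "nat \<Rightarrow> real" and K n
  define B where "B y K M n = {0..1} - (\<Union>k\<in>{M..<n}. A y K k)" for y K M n
  \<comment> \<open>The proportion on intervals, halved by
    \<open>eventually_measure_Int_ge\<close>.\<close>
  define q where "q K n = (\<epsilon> K)\<^sup>2 / (48 * real m * (17 + 2 * real m) * Y * real n) / 2" for K n
  have A_meas: "A y K n \<in> sets lebesgue" for y K n by (simp add: A_def near_cusps_measurable)
  \<comment> \<open>The sets \<open>B y K M n\<close> involve only values of \<open>y\<close> before
    \<open>n\<close>, so this is a condition on the next value \<open>r\<close>. Restricting to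
    \<open>K, M \<le> n\<close> leaves finitely many requirements, each true for all small
    \<open>r\<close>, while every pair \<open>K \<le> M\<close> is still treated at all
    \<open>n \<ge> M\<close>.\<close>
  define \<Phi> where "\<Phi> y n r \<longleftrightarrow> (n \<in> P_set m \<longrightarrow> 0 < r \<and> r < c n) \<and>
    (good n \<longrightarrow> (\<forall>K\<in>{..n}. \<forall>M\<in>{..n}. q K n * ?\<mu> (B y K M n) \<le> ?\<mu> (near_cusps Y n (\<epsilon> K) r \<inter> B y K M n)))"
    for y n r
  have "\<exists>y. \<forall>n. \<Phi> y n (y n)"
  proof (rule dependent_wellorder_choice)
    fix r :: real and f g :: "nat \<Rightarrow> real" and n :: nat
    assume fg: "\<And>k. k < n \<Longrightarrow> f k = g k"
    have "B f K M n = B g K M n" for K M unfolding B_def A_def using fg by (auto cong: if_cong)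
    thus "\<Phi> f n r = \<Phi> g n r" by (simp add: \<Phi>_def)
  next
    fix n :: nat and y :: "nat \<Rightarrow> real"
    show "\<exists>r. \<Phi> y n r"
    proof (cases "n \<in> P_set m")
      case False
      thus ?thesis by (auto simp: \<Phi>_def good_def)
    next
      case True
      obtain l where l: "prime l" "\<not> l dvd m" "n = m * l" using True by (auto simp: P_set_def)
      have "\<forall>\<^sub>F r in at_right 0. 0 < r \<and> r < c n"
        using assms(3) True by (auto simp: eventually_at_right_field intro!: exI[of _ "c n"])
      moreover have "\<forall>\<^sub>F r in at_right 0. \<forall>K\<in>{..n}. \<forall>M\<in>{..n}.
          q K n * ?\<mu> (B y K M n) \<le> ?\<mu> (near_cusps Y n (\<epsilon> K) r \<inter> B y K M n)" if g: "good n"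
      proof (intro eventually_ball_finite ballI finite_atMost)
        fix K M
        have nY: "real n * Y \<ge> 1" using g by (simp add: good_def)
        have Bm: "B y K M n \<in> lmeasurable" unfolding B_def
          using A_meas by (intro fmeasurable_Diff) (auto intro!: sets.countable_UN')
        show "\<forall>\<^sub>F r in at_right 0. q K n * ?\<mu> (B y K M n) \<le> ?\<mu> (near_cusps Y n (\<epsilon> K) r \<inter> B y K M n)"
          unfolding q_def
        proof (rule eventually_measure_Int_ge[where a = 0 and b = 1])
          show "\<forall>\<^sub>F r in at_right 0. (\<epsilon> K)\<^sup>2 / (48 * real m * (17 + 2 * real m) * Y * real n) * (b - a)
              \<le> ?\<mu> (near_cusps Y n (\<epsilon> K) r \<inter> {a..b})" if "a < b" for a b
            by (rule near_cusps_interval_measure[OF m l assms(1) nY \<epsilon> that])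
          show "B y K M n \<subseteq> {0..1}" by (auto simp: B_def)
        qed (use Bm near_cusps_measurable assms(1) in auto)
      qed
      ultimately have "\<forall>\<^sub>F r in at_right 0. \<Phi> y n r" unfolding \<Phi>_def
        by (cases "good n") (auto elim: eventually_elim2 eventually_mono)
      thus ?thesis by (rule eventually_happens'[rotated]) simp
    qed
  qed
  then obtain y where y: "\<And>n. \<Phi> y n (y n)" by blast
  have y_pos: "0 < y n" "y n < c n" if "n \<in> P_set m" for n using y[of n] that by (simp_all add: \<Phi>_def)
  have inf: "AE x in lebesgue. x \<in> {0..1} \<longrightarrow> infinite {n. x \<in> A y K n}" for K
  proof (rule AE_infinitely_often_of_proportions[where K = K and c = "\<lambda>n. if good n then q K n else 0"])
    show "A y K n \<in> sets lebesgue" for n by (rule A_meas)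
    show "(if good n then q K n else 0) \<ge> 0" for n using assms(1) by (simp add: q_def)
    show "\<not> summable (\<lambda>n. if good n then q K n else 0)"
    proof
      assume "summable (\<lambda>n. if good n then q K n else 0)"
      \<comment> \<open>Cancels the constant in \<open>q\<close>, with
        \<open>96 = 48 * 2\<close>.\<close>
      define d where "d = 96 * real m * (17 + 2 * real m) * Y / (\<epsilon> K)\<^sup>2"
      have "summable (\<lambda>n. d * (if good n then q K n else 0))"
        by (rule summable_mult) fact
      moreover have "\<forall>\<^sub>F n in sequentially. d * (if good n then q K n else 0) = (if n \<in> P_set m then 1 / real n else 0)"
      proof -
        obtain N :: nat where N: "real N > 1 / Y" using reals_Archimedean2 by blast
        have "d * q K n = 1 / real n" for n
        proof -
          have "17 + 2 * real m > 0" by simp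
          moreover have "\<epsilon> K > 0" by (rule \<epsilon>)
          ultimately show ?thesis using assms(1) m unfolding d_def q_def by (simp add: divide_simps)
        qed
        moreover have "good n \<longleftrightarrow> n \<in> P_set m" if "n \<ge> N" for n
        proof -
          have "real n > 1 / Y" using N that by linarith
          thus ?thesis using assms(1) by (simp add: good_def field_simps)
        qed
        ultimately have "\<And>n. n \<ge> N \<Longrightarrow> d * (if good n then q K n else 0) = (if n \<in> P_set m then 1 / real n else 0)"
          by simp
        thus ?thesis using eventually_ge_at_top[of N] by (rule eventually_mono[rotated])
      qed
      ultimately have "summable (\<lambda>n. if n \<in> P_set m then 1 / real n else 0)" by (simp only: summable_cong)
      thus False using not_summable_inverse_P_set[OF m] by simp
    qed
    fix M n assume Mn: "K \<le> M" "M \<le> n"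
    show "(if good n then q K n else 0) * ?\<mu> ({0..1} - (\<Union>k\<in>{M..<n}. A y K k))
      \<le> ?\<mu> (A y K n \<inter> ({0..1} - (\<Union>k\<in>{M..<n}. A y K k)))"
      using y[of n] Mn unfolding \<Phi>_def B_def[symmetric] by (auto simp: A_def)
  qed simp
  have "AE x in lebesgue. \<forall>K. x \<in> {0..1} \<longrightarrow> infinite {n. x \<in> A y K n}"
    unfolding AE_all_countable using inf by blast
  \<comment> \<open>Lebesgue measure is the completion of \<open>lborel\<close>, so the two have the
    same almost-everywhere statements.\<close>
  hence ae: "AE x in lborel. \<forall>K. x \<in> {0..1} \<longrightarrow> infinite {n. x \<in> A y K n}"
    by (simp only: AE_completion_iff)
  have "AE x in lborel. x \<in> {0..<1} \<longrightarrow>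
      (\<exists>r :: nat \<Rightarrow> nat. strict_mono r \<and> (\<forall>k. r k \<in> P_set m) \<and>
         (\<forall>f. test_fun f \<longrightarrow>
            (\<lambda>k. delta_int (r k) x (y (r k)) f) \<longlonglongrightarrow> nu_int m Y f))"
    using ae
  proof eventually_elim
    case (elim x)
    show ?case
    proof
      assume "x \<in> {0..<1}"
      hence "infinite {n. x \<in> A y K n}" for K using elim by auto
      \<comment> \<open>The subsequence is chosen before any test function, so a single
        \<open>r\<close> serves for all \<open>f\<close>.\<close>
      from exists_diagonal_subsequence[of "\<lambda>K n. x \<in> A y K n", OF this]
      obtain r where r: "strict_mono r" "\<And>k. x \<in> A y k (r k)" by blast
      have r_good: "good (r k)" "x \<in> near_cusps Y (r k) (\<epsilon> k) (y (r k))" for k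
        using r(2)[of k] by (auto simp: A_def split: if_splits)
      have rP: "r k \<in> P_set m" for k using r_good(1) by (simp add: good_def)
      have "(\<lambda>k. delta_int (r k) x (y (r k)) f) \<longlonglongrightarrow> nu_int m Y f" if f: "test_fun f" for f
      proof (rule tendstoI)
        fix \<eta> :: real assume \<eta>: "\<eta> > 0"
        obtain \<epsilon>0 n0 where *: "\<epsilon>0 > 0"
          "\<And>n \<epsilon> x y. \<lbrakk>n \<in> P_set m; n \<ge> n0; 0 < \<epsilon>; \<epsilon> < \<epsilon>0; y > 0; x \<in> near_cusps Y n \<epsilon> y\<rbrakk> \<Longrightarrow>
             \<bar>delta_int n x y f - nu_int m Y f\<bar> \<le> \<eta> / 2"
          using delta_int_near_cusps[OF f m assms(1), of "\<eta> / 2"] \<eta> by (metis half_gt_zero)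
        have "\<epsilon> \<longlonglongrightarrow> 0" unfolding \<epsilon>_def by real_asymp
        hence "\<forall>\<^sub>F k in sequentially. \<epsilon> k < \<epsilon>0" using *(1) by (rule order_tendstoD)
        moreover have "\<forall>\<^sub>F k in sequentially. r k \<ge> n0"
          using filterlim_subseq[OF r(1)] by (simp add: filterlim_at_top)
        ultimately show "\<forall>\<^sub>F k in sequentially. dist (delta_int (r k) x (y (r k)) f) (nu_int m Y f) < \<eta>"
        proof eventually_elim
          case (elim k)
          have "\<bar>delta_int (r k) x (y (r k)) f - nu_int m Y f\<bar> \<le> \<eta> / 2"
            using elim rP r_good y_pos \<epsilon> by (intro *(2)[of _ "\<epsilon> k"]) auto
          thus ?case using \<eta> by (simp add: dist_real_def)
        qed
      qed
      thus "\<exists>r :: nat \<Rightarrow> nat. strict_mono r \<and> (\<forall>k. r k \<in> P_set m) \<and>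
         (\<forall>f. test_fun f \<longrightarrow> (\<lambda>k. delta_int (r k) x (y (r k)) f) \<longlonglongrightarrow> nu_int m Y f)"
        using r(1) rP by blast
    qed
  qed
  thus ?thesis using y_pos by blast
qed

end
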